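(* Let $A$ be an associative unital $k$-algebra and $D(A)=\bigoplus_{n\ge0}D_n(A)$. For $P\in D_n(A)$, $Q\in D_m(A)$ define $Q\circ P$ by $$(Q\circ P)_\lambda=\sum_{\lambda=\lambda'+\lambda''}Q_{\lambda'}\circ P_{\lambda''},$$ where $d=|\lambda|$ and the sum is over all $\lambda'\in\Lambda_d(m)$, $\lambda''\in\Lambda_d(n)$ with termwise sum $\lambda$. Then $Q\circ P\in D_{m+n}(A)$ and $(D(A),\circ)$ is an associative algebra.
   Context: $k$ is the ground field, $\otimes=\otimes_k$. $\Lambda_d(n)$: ordered partitions $\lambda=(\lambda_1,\dots,\lambda_d)$ of $n\ge0$ with all $\lambda_i\ge0$; $|\lambda|=d$. $\lambda$ is degenerate if $n>0$ and some $\lambda_i=0$, or $n=0$ and $d>1$; $\Lambda_d^\circ(n)$ denotes the set of non-degenerate ones. For $\mu\in\Lambda_l(\lambda_i)$, $\mu\circ_i\lambda=(\lambda_1,\dots,\lambda_{i-1},\mu_1,\dots,\mu_l,\lambda_{i+1},\dots,\lambda_d)$. For $n\ge1$, $D_n(A)$ (differential operators at $\mathrm{id}_A$) is the space of families $P=\{P_\lambda\in\mathrm{Hom}_k(A^{\otimes d},A^{\otimes d}):\lambda\in\Lambda^\circ_d(n),\ d\ge1\}$ such that for every $\lambda\in\Lambda_d^\circ(n)$ and $1\le i\le d$ $$P_\lambda(\dots,a_ia_i',\dots)=a_i\cdot_iP_\lambda(\dots,a_i',\dots)+P_\lambda(\dots,a_i,\dots)\cdot_ia_i'+\sum_{\mu\in\Lambda_2^\circ(\lambda_i)}m^{(i)}P_{\mu\circ_i\lambda}(\dots,a_i,a_i',\dots),$$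 where $\cdot_i$ is multiplication in the $i$-th tensor factor and $m^{(i)}$ multiplies factors $i$ and $i+1$ (empty sums are $0$). $D_0(A)=k\cdot\mathrm{id}_A=k$. A family $P$ is extended to all $\lambda\in\Lambda_d(n)$, including degenerate ones: if $P_\lambda(a_1,\dots,a_d)=\sum b^{(1)}\otimes\dots\otimes b^{(d)}$ and $\lambda'=(\lambda_1,\dots,\lambda_i,0,\lambda_{i+1},\dots,\lambda_d)$, then $P_{\lambda'}(a_1,\dots,a_i,a,a_{i+1},\dots,a_d)=\sum b^{(1)}\otimes\dots\otimes b^{(i)}\otimes a\otimes b^{(i+1)}\otimes\dots\otimes b^{(d)}$. For $c\in k=D_0(A)$, $c_{(0,\dots,0)}=c\cdot\mathrm{id}_{A^{\otimes d}}$. *)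

theory Defs
  imports Complex_Main "HOL-Library.Function_Algebras"
begin

section \<open>Associative unital algebras\<close>

text \<open>
  An associative unital algebra carried by a subspace \<open>V\<close> of an ambient vector space.  The algebra
  \<open>A\<close> is the case where \<open>V\<close> is a whole type of sort \<open>{ring, monoid_mult}\<close> (not \<open>ring_1\<close>, which
  would exclude the zero algebra).
\<close>

locale assoc_algebra_on = vector_space scale
  for V :: "'v::ab_group_add set" and scale :: "'k::field \<Rightarrow> 'v \<Rightarrow> 'v"
    and mul :: "'v \<Rightarrow> 'v \<Rightarrow> 'v" and unit :: 'v +
  assumes subspace: "subspace V"
    and mul_closed: "x \<in> V \<Longrightarrow> y \<in> V \<Longrightarrow> mul x y \<in> V"
    and unit_closed: "unit \<in> V"
    and add_mul: "x \<in> V \<Longrightarrow> y \<in> V \<Longrightarrow> z \<in> V \<Longrightarrow> mul (x + y) z = mul x z + mul y z"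
    and mul_add: "x \<in> V \<Longrightarrow> y \<in> V \<Longrightarrow> z \<in> V \<Longrightarrow> mul x (y + z) = mul x y + mul x z"
    and scale_mul: "x \<in> V \<Longrightarrow> y \<in> V \<Longrightarrow> mul (scale c x) y = scale c (mul x y)"
    and mul_scale: "x \<in> V \<Longrightarrow> y \<in> V \<Longrightarrow> mul x (scale c y) = scale c (mul x y)"
    and mul_assoc: "x \<in> V \<Longrightarrow> y \<in> V \<Longrightarrow> z \<in> V \<Longrightarrow> mul (mul x y) z = mul x (mul y z)"
    and unit_mul: "x \<in> V \<Longrightarrow> mul unit x = x"
    and mul_unit: "x \<in> V \<Longrightarrow> mul x unit = x"


section \<open>Tensor powers\<close>

text \<open>
  Here and below \<open>scale\<close> is the scalar multiplication of \<open>A\<close>.  A map out of \<open>A\<^sup>d\<close> is a function on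
  lists, of which only the values at lists of length \<open>d\<close> matter.
\<close>

definition multilinear ::
    "('k::field \<Rightarrow> 'a::ab_group_add \<Rightarrow> 'a) \<Rightarrow> ('k \<Rightarrow> 'b::ab_group_add \<Rightarrow> 'b) \<Rightarrow> nat \<Rightarrow> ('a list \<Rightarrow> 'b) \<Rightarrow> bool"
  where "multilinear scale scale' d g \<longleftrightarrow>
    (\<forall>xs i. length xs = d \<longrightarrow> i < d \<longrightarrow> Vector_Spaces.linear scale scale' (\<lambda>a. g (xs[i := a])))"

text \<open>
  The scalars form a field, so the \<open>d\<close>-th tensor power may be realised inside the dual of the space
  of \<open>d\<close>-linear forms: \<open>a\<^sub>1 \<otimes> \<dots> \<otimes> a\<^sub>d\<close> is evaluation at \<open>(a\<^sub>1, \<dots>, a\<^sub>d)\<close>.  Functionals are set to \<open>0\<close>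
  on functions that are not \<open>d\<close>-linear.  That this is the tensor power is the universal property
  proved in \<open>tensor_power_universal\<close> and \<open>tensor_power_universal_unique\<close>.
\<close>

type_synonym ('k, 'a) tensor = "('a list \<Rightarrow> 'k) \<Rightarrow> 'k"

definition tscale :: "'k::field \<Rightarrow> ('k, 'a) tensor \<Rightarrow> ('k, 'a) tensor"
  where "tscale c t = (\<lambda>f. c * t f)"

definition tens :: "('k::field \<Rightarrow> 'a::ab_group_add \<Rightarrow> 'a) \<Rightarrow> 'a list \<Rightarrow> ('k, 'a) tensor"
  where "tens scale xs = (\<lambda>f. if multilinear scale (*) (length xs) f then f xs else 0)"

definition tensor_power :: "('k::field \<Rightarrow> 'a::ab_group_add \<Rightarrow> 'a) \<Rightarrow> nat \<Rightarrow> ('k, 'a) tensor set"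
  where "tensor_power scale d = module.span tscale (tens scale ` {xs. length xs = d})"

lemma vector_space_tscale: "vector_space tscale"
  by unfold_locales (auto simp: tscale_def fun_eq_iff algebra_simps)

lemma vector_space_mult: "vector_space ((*) :: 'k::field \<Rightarrow> 'k \<Rightarrow> 'k)"
  by unfold_locales (auto simp: algebra_simps)

lemma multilinear_tens:
  assumes "vector_space scale"
  shows "multilinear scale tscale d (tens scale)"
proof -
  interpret vector_space scale by fact
  have "module_hom scale tscale (\<lambda>a. tens scale (xs[i := a]))" if "i < length xs" for xs i
  proof -
    have lin: "Vector_Spaces.linear scale (*) (\<lambda>a. f (xs[i := a]))"
      if "multilinear scale (*) (length xs) f" for f
      using that \<open>i < length xs\<close> by (auto simp: multilinear_def)
    show ?thesis
      using lin[THEN Vector_Spaces.linear_iff[THEN iffD1]] assms vector_space_tscale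
      by (auto simp: module_hom_iff module_iff_vector_space tens_def tscale_def fun_eq_iff)
  qed
  then show ?thesis
    by (auto simp: multilinear_def module_hom_iff_linear)
qed

theorem tensor_power_universal:
  assumes "vector_space scale" "vector_space scale'" "multilinear scale scale' d g"
  shows "\<exists>h. Vector_Spaces.linear tscale scale' h \<and> (\<forall>xs. length xs = d \<longrightarrow> h (tens scale xs) = g xs)"
proof -
  interpret T: vector_space tscale by (rule vector_space_tscale)
  interpret W: vector_space scale' by fact
  interpret K: vector_space "(*) :: 'a \<Rightarrow> 'a \<Rightarrow> 'a" by (rule vector_space_mult)
  interpret TW: vector_space_pair tscale scale' ..
  interpret WK: vector_space_pair scale' "(*) :: 'a \<Rightarrow> 'a \<Rightarrow> 'a" ..
  let ?S = "tens scale ` {xs. length xs = d}"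
  obtain B where B: "B \<subseteq> ?S" "T.independent B" "T.span B = T.span ?S"
  proof (rule T.maximal_independent_subset[of ?S])
    fix B
    assume B: "B \<subseteq> ?S" "T.independent B" "?S \<subseteq> T.span B"
    then have "T.span B = T.span ?S"
      unfolding T.span_eq using T.span_superset[of ?S] by blast
    with B(1,2) show thesis by (rule that)
  qed
  define y where "y b = (SOME xs. length xs = d \<and> tens scale xs = b)" for b
  have y: "length (y b) = d \<and> tens scale (y b) = b" if "b \<in> B" for b
    unfolding y_def by (rule someI_ex) (use that B(1) in auto)
  obtain h where h: "Vector_Spaces.linear tscale scale' h" "\<forall>b\<in>B. h b = g (y b)"
    using TW.linear_independent_extend[OF B(2), of "\<lambda>b. g (y b)"] by blast
  have "h (tens scale xs) = g xs" if xs: "length xs = d" for xs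
  proof (rule ccontr)
    assume "h (tens scale xs) \<noteq> g xs"
    define w where "w = h (tens scale xs) - g xs"
    then have "w \<noteq> 0" using \<open>h (tens scale xs) \<noteq> g xs\<close> by simp
    obtain p where p: "Vector_Spaces.linear scale' (*) p" "p w = 1"
      using WK.linear_independent_extend[of "{w}" "\<lambda>_. 1"] \<open>w \<noteq> 0\<close> by auto
    interpret h: Vector_Spaces.linear tscale scale' h by (fact h(1))
    interpret p: Vector_Spaces.linear scale' "(*)" p by (fact p(1))
    have ml: "multilinear scale (*) d (\<lambda>xs. p (g xs))"
      using assms(3) Vector_Spaces.linear_compose[OF _ p(1)] by (auto simp: multilinear_def o_def)
    have key: "p (h t) = t (\<lambda>xs. p (g xs))" if "t \<in> T.span B" for t
    proof (rule T.span_induct_alt[OF that])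
      have "p (h 0) = 0" by (simp only: h.zero p.zero)
      then show "p (h 0) = 0 (\<lambda>xs. p (g xs))" by simp
      fix c b t
      assume b: "b \<in> B" and t: "p (h t) = t (\<lambda>xs. p (g xs))"
      have "p (h b) = b (\<lambda>xs. p (g xs))"
        using h(2) b y[OF b] ml by (metis tens_def)
      moreover have "p (h (tscale c b + t)) = c * p (h b) + p (h t)"
        by (simp only: h.add h.scale p.add p.scale)
      ultimately show "p (h (tscale c b + t)) = (tscale c b + t) (\<lambda>xs. p (g xs))"
        using t by (simp add: tscale_def)
    qed
    have "tens scale xs \<in> T.span B"
      using xs B(3) by (auto intro: T.span_base)
    from key[OF this] have "p (h (tens scale xs)) = p (g xs)"
      using ml xs by (simp add: tens_def)
    then have "p w = 0" by (simp add: w_def p.diff)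
    with p(2) show False by simp
  qed
  with h(1) show "\<exists>h. Vector_Spaces.linear tscale scale' h \<and>
      (\<forall>xs. length xs = d \<longrightarrow> h (tens scale xs) = g xs)" by blast
qed

lemma tensor_power_universal_unique:
  assumes "vector_space scale'" "Vector_Spaces.linear tscale scale' h" "Vector_Spaces.linear tscale scale' h'"
    and eq: "\<forall>xs. length xs = d \<longrightarrow> h (tens scale xs) = h' (tens scale xs)"
    and t: "t \<in> tensor_power scale d"
  shows "h t = h' t"
proof -
  interpret T: vector_space tscale by (rule vector_space_tscale)
  interpret W: vector_space scale' by fact
  interpret TW: vector_space_pair tscale scale' ..
  show ?thesis
    by (rule TW.linear_eq_on[OF assms(2,3) t[unfolded tensor_power_def]]) (use eq in force)
qed

text \<open>
  Linear maps between tensor powers are extended by \<open>0\<close> outside their domain, so that equal maps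
  are equal functions.
\<close>

definition thom ::
    "('k::field \<Rightarrow> 'a::ab_group_add \<Rightarrow> 'a) \<Rightarrow> nat \<Rightarrow> nat \<Rightarrow> (('k, 'a) tensor \<Rightarrow> ('k, 'a) tensor) set"
  where "thom scale d e = {h.
    (\<forall>t \<in> tensor_power scale d. h t \<in> tensor_power scale e) \<and>
    (\<forall>t \<in> tensor_power scale d. \<forall>u \<in> tensor_power scale d. h (t + u) = h t + h u) \<and>
    (\<forall>c. \<forall>t \<in> tensor_power scale d. h (tscale c t) = tscale c (h t)) \<and>
    (\<forall>t. t \<notin> tensor_power scale d \<longrightarrow> h t = 0)}"

definition tid :: "('k::field \<Rightarrow> 'a::ab_group_add \<Rightarrow> 'a) \<Rightarrow> nat \<Rightarrow> ('k, 'a) tensor \<Rightarrow> ('k, 'a) tensor"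
  where "tid scale d t = (if t \<in> tensor_power scale d then t else 0)"

text \<open>
  For a \<open>d\<close>-linear \<open>g\<close> with values in a tensor power, \<open>tlift scale d g\<close> is the linear map on the
  \<open>d\<close>-th tensor power with \<open>a\<^sub>1 \<otimes> \<dots> \<otimes> a\<^sub>d \<mapsto> g (a\<^sub>1, \<dots>, a\<^sub>d)\<close>; see \<open>tlift_tens\<close> and \<open>tlift_thom\<close>.
\<close>

definition tlift :: "('k::field \<Rightarrow> 'a::ab_group_add \<Rightarrow> 'a) \<Rightarrow> nat \<Rightarrow> ('a list \<Rightarrow> ('k, 'a) tensor) \<Rightarrow>
    ('k, 'a) tensor \<Rightarrow> ('k, 'a) tensor"
  where "tlift scale d g t = (if t \<in> tensor_power scale d then (\<lambda>f. t (\<lambda>xs. g xs f)) else 0)"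

lemma tens_in_power: "length xs = d \<Longrightarrow> tens scale xs \<in> tensor_power scale d"
  unfolding tensor_power_def
  by (rule module.span_base) (use vector_space_tscale module_iff_vector_space in auto)

lemma subspace_tensor_power: "module.subspace tscale (tensor_power scale d)"
  unfolding tensor_power_def
  by (rule module.subspace_span) (use vector_space_tscale module_iff_vector_space in auto)

lemma tensor_power_induct [consumes 1, case_names zero step]:
  assumes "t \<in> tensor_power scale d" and "Q 0"
    and "\<And>c xs t. length xs = d \<Longrightarrow> t \<in> tensor_power scale d \<Longrightarrow> Q t \<Longrightarrow> Q (tscale c (tens scale xs) + t)"
  shows "Q t"
proof -
  interpret T: vector_space tscale by (rule vector_space_tscale)
  note sub = subspace_tensor_power[of scale d]
  have "t \<in> tensor_power scale d \<and> Q t"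
  proof (rule T.span_induct_alt[OF assms(1)[unfolded tensor_power_def]])
    show "0 \<in> tensor_power scale d \<and> Q 0"
      using assms(2) T.subspace_0[OF sub] by (rule conjI[rotated])
    fix c b t
    assume b: "b \<in> tens scale ` {xs. length xs = d}" and t: "t \<in> tensor_power scale d \<and> Q t"
    from b obtain xs where "length xs = d" "b = tens scale xs" by blast
    with t show "tscale c b + t \<in> tensor_power scale d \<and> Q (tscale c b + t)"
      using assms(3)[of xs t c] tens_in_power[of xs d scale] T.subspace_add[OF sub]
        T.subspace_scale[OF sub] by blast
  qed
  then show ?thesis ..
qed

lemma tlift_tens:
  assumes "multilinear scale tscale d g" "length xs = d"
  shows "tlift scale d g (tens scale xs) = g xs"
proof -
  have "multilinear scale (*) d (\<lambda>xs. g xs f)" for f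
    using assms(1)
    unfolding multilinear_def Vector_Spaces.linear_iff
    by (auto simp: tscale_def vector_space_mult)
  then show ?thesis
    using assms(2) by (simp add: tlift_def tens_in_power) (simp add: tens_def)
qed

lemma thom_combine:
  assumes "h \<in> thom scale d e" "t \<in> tensor_power scale d" "u \<in> tensor_power scale d"
  shows "h (tscale c t + u) = tscale c (h t) + h u"
proof -
  interpret T: vector_space tscale by (rule vector_space_tscale)
  have "tscale c t \<in> tensor_power scale d"
    by (rule T.subspace_scale[OF subspace_tensor_power assms(2)])
  moreover have "h (t + u) = h t + h u" if "t \<in> tensor_power scale d" for t
    using assms(1,3) that unfolding thom_def by blast
  moreover have "h (tscale c t) = tscale c (h t)"
    using assms(1,2) unfolding thom_def by blast
  ultimately show ?thesis by metis
qed

lemma thom_zero: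
  assumes "h \<in> thom scale d e"
  shows "h 0 = 0"
proof -
  interpret T: vector_space tscale by (rule vector_space_tscale)
  show ?thesis
    using assms T.subspace_0[OF subspace_tensor_power[of scale d]] unfolding thom_def
    by (metis (mono_tags, lifting) T.scale_zero_left mem_Collect_eq)
qed

lemma tlift_thom:
  assumes "multilinear scale tscale d g" "\<And>xs. length xs = d \<Longrightarrow> g xs \<in> tensor_power scale e"
  shows "tlift scale d g \<in> thom scale d e"
proof -
  interpret T: vector_space tscale by (rule vector_space_tscale)
  note sub = subspace_tensor_power[of scale d] and sub' = subspace_tensor_power[of scale e]
  have add: "tlift scale d g (t + u) = tlift scale d g t + tlift scale d g u"
    if "t \<in> tensor_power scale d" "u \<in> tensor_power scale d" for t u
    using that T.subspace_add[OF sub] by (simp add: tlift_def fun_eq_iff)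
  have scl: "tlift scale d g (tscale c t) = tscale c (tlift scale d g t)"
    if "t \<in> tensor_power scale d" for c t
    using that T.subspace_scale[OF sub] by (simp add: tlift_def tscale_def)
  have "tlift scale d g t \<in> tensor_power scale e" if "t \<in> tensor_power scale d" for t
  proof (rule tensor_power_induct[OF that])
    have "tlift scale d g 0 = 0" by (simp add: tlift_def fun_eq_iff)
    then show "tlift scale d g 0 \<in> tensor_power scale e"
      using T.subspace_0[OF sub'] by metis
    fix c t and xs :: "'b list"
    assume *: "length xs = d" "t \<in> tensor_power scale d" "tlift scale d g t \<in> tensor_power scale e"
    have "tlift scale d g (tscale c (tens scale xs) + t) = tscale c (g xs) + tlift scale d g t"
      using * add scl tens_in_power[OF *(1)] T.subspace_scale[OF sub] tlift_tens[OF assms(1)] by metis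
    then show "tlift scale d g (tscale c (tens scale xs) + t) \<in> tensor_power scale e"
      using * assms(2) T.subspace_add[OF sub'] T.subspace_scale[OF sub'] by metis
  qed
  with add scl show ?thesis by (auto simp: thom_def) (simp add: tlift_def)
qed

lemma thom_eqI:
  assumes h: "h \<in> thom scale d e" and h': "h' \<in> thom scale d e"
    and eq: "\<And>xs. length xs = d \<Longrightarrow> h (tens scale xs) = h' (tens scale xs)"
  shows "h = h'"
proof
  fix t
  show "h t = h' t"
  proof (cases "t \<in> tensor_power scale d")
    case True
    show ?thesis
    proof (rule tensor_power_induct[OF True])
      show "h 0 = h' 0"
        using thom_zero[OF h] thom_zero[OF h'] by metis
    next
      fix c t and xs :: "'a list"
      assume "length xs = d" "t \<in> tensor_power scale d" "h t = h' t"
      then show "h (tscale c (tens scale xs) + t) = h' (tscale c (tens scale xs) + t)"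
        using thom_combine[OF h] thom_combine[OF h'] eq tens_in_power by metis
    qed
  qed (use h h' in \<open>simp add: thom_def\<close>)
qed

lemma thom_comp: "h \<in> thom scale d e \<Longrightarrow> h' \<in> thom scale e f \<Longrightarrow> (\<lambda>t. h' (h t)) \<in> thom scale d f"
  using thom_zero[of h' scale e f] by (simp add: thom_def)

lemma multilinear_reindex:
  assumes "multilinear scale scale' e h"
    and "\<And>xs. length xs = d \<Longrightarrow> length (g xs) = e"
    and "\<And>j. j < d \<Longrightarrow> \<exists>j'<e. \<forall>xs a. length xs = d \<longrightarrow> g (xs[j := a]) = (g xs)[j' := a]"
  shows "multilinear scale scale' d (\<lambda>xs. h (g xs))"
  unfolding multilinear_def
proof (intro allI impI)
  fix xs :: "'b list" and j
  assume "length xs = d" "j < d"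
  with assms(3) obtain j' where "j' < e" "\<forall>a. g (xs[j := a]) = (g xs)[j' := a]" by metis
  then show "Vector_Spaces.linear scale scale' (\<lambda>a. h (g (xs[j := a])))"
    using assms(1,2) \<open>length xs = d\<close> by (simp add: multilinear_def)
qed

text \<open>Tensor factors are numbered from \<open>0\<close>, and \<open>d\<close> is the number of factors of the argument.\<close>

definition lmul_at :: "('k::field \<Rightarrow> 'a::{ring,monoid_mult} \<Rightarrow> 'a) \<Rightarrow> nat \<Rightarrow> nat \<Rightarrow> 'a \<Rightarrow>
    ('k, 'a) tensor \<Rightarrow> ('k, 'a) tensor"
  where "lmul_at scale d i a = tlift scale d (\<lambda>xs. tens scale (xs[i := a * xs ! i]))"

definition rmul_at :: "('k::field \<Rightarrow> 'a::{ring,monoid_mult} \<Rightarrow> 'a) \<Rightarrow> nat \<Rightarrow> nat \<Rightarrow> 'a \<Rightarrow>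
    ('k, 'a) tensor \<Rightarrow> ('k, 'a) tensor"
  where "rmul_at scale d i a = tlift scale d (\<lambda>xs. tens scale (xs[i := xs ! i * a]))"

definition merge_at :: "('k::field \<Rightarrow> 'a::{ring,monoid_mult} \<Rightarrow> 'a) \<Rightarrow> nat \<Rightarrow> nat \<Rightarrow>
    ('k, 'a) tensor \<Rightarrow> ('k, 'a) tensor"
  where "merge_at scale d i =
    tlift scale d (\<lambda>xs. tens scale (take i xs @ xs ! i * xs ! Suc i # drop (i + 2) xs))"

definition insert_at :: "('k::field \<Rightarrow> 'a::ab_group_add \<Rightarrow> 'a) \<Rightarrow> nat \<Rightarrow> nat \<Rightarrow> 'a \<Rightarrow>
    ('k, 'a) tensor \<Rightarrow> ('k, 'a) tensor"
  where "insert_at scale d i a = tlift scale d (\<lambda>ys. tens scale (take i ys @ a # drop i ys))"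

lemma multilinear_insert:
  assumes "vector_space scale" "i \<le> d"
  shows "multilinear scale tscale d (\<lambda>ys. tens scale (take i ys @ a # drop i ys))"
proof (rule multilinear_reindex[OF multilinear_tens[OF assms(1), of "Suc d"]])
  show "\<exists>j'<Suc d. \<forall>xs b. length xs = d \<longrightarrow>
      take i (xs[j := b]) @ a # drop i (xs[j := b]) = (take i xs @ a # drop i xs)[j' := b]"
    if "j < d" for j
    using that assms(2)
    by (intro exI[of _ "if j < i then j else Suc j"])
      (auto simp: list_update_append take_update_swap drop_update_swap Suc_diff_le list_update_beyond)
qed (use assms(2) in auto)

lemma insert_at_tens:
  assumes "vector_space scale" "i \<le> d" "length ys = d"
  shows "insert_at scale d i a (tens scale ys) = tens scale (take i ys @ a # drop i ys)"
  unfolding insert_at_def by (rule tlift_tens[OF multilinear_insert[OF assms(1,2)] assms(3)])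

lemma insert_at_thom:
  assumes "vector_space scale" "i \<le> d"
  shows "insert_at scale d i a \<in> thom scale d (Suc d)"
  unfolding insert_at_def
  by (rule tlift_thom[OF multilinear_insert[OF assms]]) (use assms(2) in \<open>auto intro!: tens_in_power\<close>)

lemma linear_insert_at:
  assumes "vector_space scale" "i \<le> d" "t \<in> tensor_power scale d"
  shows "Vector_Spaces.linear scale tscale (\<lambda>a. insert_at scale d i a t)"
proof -
  interpret T: vector_space tscale by (rule vector_space_tscale)
  have ia: "insert_at scale d i a \<in> thom scale d (Suc d)" for a
    by (rule insert_at_thom[OF assms(1,2)])
  have pure: "Vector_Spaces.linear scale tscale (\<lambda>a. tens scale (take i ys @ a # drop i ys))"
    if "length ys = d" for ys
  proof -
    have "(take i ys @ 0 # drop i ys)[i := a] = take i ys @ a # drop i ys" for a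
      using that assms(2) by (simp add: list_update_append)
    then show ?thesis
      using multilinear_tens[OF assms(1), of "Suc d", unfolded multilinear_def, rule_format,
          of "take i ys @ 0 # drop i ys" i] that assms(2) by simp
  qed
  show ?thesis
  proof (rule tensor_power_induct[OF assms(3)])
    have "Vector_Spaces.linear scale tscale (\<lambda>_. 0)"
      using assms(1) vector_space_tscale by (simp add: Vector_Spaces.linear_iff T.scale_zero_right)
    then show "Vector_Spaces.linear scale tscale (\<lambda>a. insert_at scale d i a 0)"
      unfolding thom_zero[OF ia] .
    fix c t and ys :: "'b list"
    assume ys: "length ys = d" and t: "t \<in> tensor_power scale d"
      and IH: "Vector_Spaces.linear scale tscale (\<lambda>a. insert_at scale d i a t)"
    have eq: "insert_at scale d i a (tscale c (tens scale ys) + t) =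
        tscale c (tens scale (take i ys @ a # drop i ys)) + insert_at scale d i a t" for a
      using thom_combine[OF ia tens_in_power[OF ys] t] insert_at_tens[OF assms(1,2) ys] by metis
    show "Vector_Spaces.linear scale tscale (\<lambda>a. insert_at scale d i a (tscale c (tens scale ys) + t))"
      unfolding eq using IH pure[OF ys]
      by (simp add: Vector_Spaces.linear_iff T.scale_right_distrib T.scale_left_commute add_ac)
  qed
qed

text \<open>
  For an endomorphism \<open>h\<close> of the \<open>d\<close>-th tensor power, the endomorphism of the next one that acts
  as the identity on factor \<open>i\<close> and as \<open>h\<close> on the remaining ones.
\<close>

definition insert_id :: "('k::field \<Rightarrow> 'a::ab_group_add \<Rightarrow> 'a) \<Rightarrow> nat \<Rightarrow> nat \<Rightarrow>
    (('k, 'a) tensor \<Rightarrow> ('k, 'a) tensor) \<Rightarrow> ('k, 'a) tensor \<Rightarrow> ('k, 'a) tensor"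
  where "insert_id scale d i h = tlift scale (Suc d)
    (\<lambda>xs. insert_at scale d i (xs ! i) (h (tens scale (take i xs @ drop (Suc i) xs))))"

lemma multilinear_insert_id:
  assumes "vector_space scale" "i \<le> d" "h \<in> thom scale d d"
  shows "multilinear scale tscale (Suc d)
    (\<lambda>xs. insert_at scale d i (xs ! i) (h (tens scale (take i xs @ drop (Suc i) xs))))"
  unfolding multilinear_def
proof (intro allI impI)
  fix xs :: "'b list" and j
  assume len: "length xs = Suc d" and j: "j < Suc d"
  let ?r = "\<lambda>xs. take i xs @ drop (Suc i) xs"
  show "Vector_Spaces.linear scale tscale
      (\<lambda>a. insert_at scale d i (xs[j := a] ! i) (h (tens scale (?r (xs[j := a])))))"
  proof (cases "j = i")
    case True
    have "h (tens scale (?r xs)) \<in> tensor_power scale d"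
      using assms(2,3) len by (auto simp: thom_def intro!: tens_in_power)
    from linear_insert_at[OF assms(1,2) this] show ?thesis
      using True len assms(2) by simp
  next
    case False
    define j' where "j' = (if j < i then j else j - 1)"
    have r: "?r (xs[j := a]) = (?r xs)[j' := a]" for a
      using False len j assms(2)
      by (auto simp: j'_def list_update_append take_update_swap drop_update_swap list_update_beyond)
    have j': "j' < d" using False j assms(2) by (auto simp: j'_def)
    have len': "length (?r xs) = d" using len assms(2) by simp
    have pow: "tens scale ((?r xs)[j' := a]) \<in> tensor_power scale d" for a
      using len' by (intro tens_in_power) simp
    have lin: "Vector_Spaces.linear scale tscale (\<lambda>a. tens scale ((?r xs)[j' := a]))"
      using multilinear_tens[OF assms(1), of d] len' j' by (auto simp: multilinear_def)
    have "(\<lambda>t. insert_at scale d i (xs ! i) (h t)) \<in> thom scale d (Suc d)"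
      by (rule thom_comp[OF assms(3) insert_at_thom[OF assms(1,2)]])
    then show ?thesis
      using lin pow False unfolding r Vector_Spaces.linear_iff
      by (simp add: thom_def)
  qed
qed

lemma insert_id_tens:
  assumes "vector_space scale" "i \<le> d" "h \<in> thom scale d d" "length xs = Suc d"
  shows "insert_id scale d i h (tens scale xs) =
    insert_at scale d i (xs ! i) (h (tens scale (take i xs @ drop (Suc i) xs)))"
  unfolding insert_id_def by (rule tlift_tens[OF multilinear_insert_id[OF assms(1-3)] assms(4)])

lemma insert_id_thom:
  assumes "vector_space scale" "i \<le> d" "h \<in> thom scale d d"
  shows "insert_id scale d i h \<in> thom scale (Suc d) (Suc d)"
  unfolding insert_id_def
proof (rule tlift_thom[OF multilinear_insert_id[OF assms]])
  fix xs :: "'b list"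
  assume "length xs = Suc d"
  then have "tens scale (take i xs @ drop (Suc i) xs) \<in> tensor_power scale d"
    using assms(2) by (intro tens_in_power) simp
  then show "insert_at scale d i (xs ! i) (h (tens scale (take i xs @ drop (Suc i) xs)))
      \<in> tensor_power scale (Suc d)"
    using assms(3) insert_at_thom[OF assms(1,2)] by (simp add: thom_def)
qed

lemma insert_insert_list:
  "j \<le> i \<Longrightarrow> i \<le> length xs \<Longrightarrow>
    take j (take i xs @ b # drop i xs) @ a # drop j (take i xs @ b # drop i xs) =
    take (Suc i) (take j xs @ a # drop j xs) @ b # drop (Suc i) (take j xs @ a # drop j xs)"
proof (induction xs arbitrary: i j)
  case (Cons x xs)
  show ?case
  proof (cases j)
    case (Suc j')
    then obtain i' where "i = Suc i'" using Cons.prems by (cases i) auto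
    then show ?thesis
      using Suc Cons.prems Cons.IH[of j' i'] by (simp del: take_append drop_append)
  qed (simp del: take_append drop_append)
qed simp

lemma remove_remove_list:
  "j \<le> i \<Longrightarrow> Suc i < length xs \<Longrightarrow>
    take i (take j xs @ drop (Suc j) xs) @ drop (Suc i) (take j xs @ drop (Suc j) xs) =
    take j (take (Suc i) xs @ drop (Suc (Suc i)) xs) @
      drop (Suc j) (take (Suc i) xs @ drop (Suc (Suc i)) xs)"
proof (induction xs arbitrary: i j)
  case (Cons x xs)
  show ?case
  proof (cases j)
    case (Suc j')
    then obtain i' where "i = Suc i'" using Cons.prems by (cases i) auto
    then show ?thesis
      using Suc Cons.prems Cons.IH[of j' i'] by (simp del: take_append drop_append)
  qed (simp del: take_append drop_append)
qed simp

lemma insert_remove_list: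
  "j \<le> i \<Longrightarrow> i < length xs \<Longrightarrow>
    take j (take (Suc i) xs @ a # drop (Suc i) xs) @ drop (Suc j) (take (Suc i) xs @ a # drop (Suc i) xs) =
    take i (take j xs @ drop (Suc j) xs) @ a # drop i (take j xs @ drop (Suc j) xs)"
proof (induction xs arbitrary: i j)
  case (Cons x xs)
  show ?case
  proof (cases j)
    case (Suc j')
    then obtain i' where "i = Suc i'" using Cons.prems by (cases i) auto
    then show ?thesis
      using Suc Cons.prems Cons.IH[of j' i'] by (simp del: take_append drop_append)
  qed (simp del: take_append drop_append)
qed simp

lemma insert_at_commute:
  assumes "vector_space scale" "j \<le> i" "i \<le> d" "t \<in> tensor_power scale d"
  shows "insert_at scale (Suc d) j a (insert_at scale d i b t) =
    insert_at scale (Suc d) (Suc i) b (insert_at scale d j a t)"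
proof -
  have "(\<lambda>t. insert_at scale (Suc d) j a (insert_at scale d i b t)) =
    (\<lambda>t. insert_at scale (Suc d) (Suc i) b (insert_at scale d j a t))"
  proof (rule thom_eqI)
    show "(\<lambda>t. insert_at scale (Suc d) j a (insert_at scale d i b t)) \<in> thom scale d (Suc (Suc d))"
      by (rule thom_comp[OF insert_at_thom[OF assms(1)] insert_at_thom[OF assms(1)]]) (use assms in auto)
    show "(\<lambda>t. insert_at scale (Suc d) (Suc i) b (insert_at scale d j a t)) \<in> thom scale d (Suc (Suc d))"
      by (rule thom_comp[OF insert_at_thom[OF assms(1)] insert_at_thom[OF assms(1)]]) (use assms in auto)
    fix xs :: "'b list"
    assume len: "length xs = d"
    then show "insert_at scale (Suc d) j a (insert_at scale d i b (tens scale xs)) =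
        insert_at scale (Suc d) (Suc i) b (insert_at scale d j a (tens scale xs))"
      using assms insert_insert_list[of j i xs b a]
      by (simp add: insert_at_tens del: take_append drop_append)
  qed
  then show ?thesis by (rule fun_cong)
qed

lemma insert_id_commute:
  assumes "vector_space scale" "j \<le> i" "i \<le> d" "h \<in> thom scale d d"
  shows "insert_id scale (Suc d) j (insert_id scale d i h) =
    insert_id scale (Suc d) (Suc i) (insert_id scale d j h)"
proof (rule thom_eqI)
  show "insert_id scale (Suc d) j (insert_id scale d i h) \<in> thom scale (Suc (Suc d)) (Suc (Suc d))"
    by (rule insert_id_thom[OF assms(1) _ insert_id_thom[OF assms(1) _ assms(4)]]) (use assms in auto)
  show "insert_id scale (Suc d) (Suc i) (insert_id scale d j h) \<in> thom scale (Suc (Suc d)) (Suc (Suc d))"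
    by (rule insert_id_thom[OF assms(1) _ insert_id_thom[OF assms(1) _ assms(4)]]) (use assms in auto)
  fix xs :: "'b list"
  assume len: "length xs = Suc (Suc d)"
  have hij: "insert_id scale d i h \<in> thom scale (Suc d) (Suc d)"
    "insert_id scale d j h \<in> thom scale (Suc d) (Suc d)"
    using assms by (auto intro!: insert_id_thom)
  let ?r = "take i (take j xs @ drop (Suc j) xs) @ drop (Suc i) (take j xs @ drop (Suc j) xs)"
  have r: "take j (take (Suc i) xs @ drop (Suc (Suc i)) xs) @
      drop (Suc j) (take (Suc i) xs @ drop (Suc (Suc i)) xs) = ?r"
    using remove_remove_list[of j i xs] len assms by simp
  have n1: "(take j xs @ drop (Suc j) xs) ! i = xs ! Suc i"
    using len assms by (simp add: nth_append)
  have n2: "(take (Suc i) xs @ drop (Suc (Suc i)) xs) ! j = xs ! j"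
    using len assms by (simp add: nth_append)
  have "h (tens scale ?r) \<in> tensor_power scale d"
    using assms len by (auto simp: thom_def intro!: tens_in_power)
  note comm = insert_at_commute[OF assms(1-3) this, of "xs ! j" "xs ! Suc i"]
  have "insert_id scale (Suc d) j (insert_id scale d i h) (tens scale xs) =
      insert_at scale (Suc d) j (xs ! j)
        (insert_id scale d i h (tens scale (take j xs @ drop (Suc j) xs)))"
    using assms len by (intro insert_id_tens hij) auto
  also have "insert_id scale d i h (tens scale (take j xs @ drop (Suc j) xs)) =
      insert_at scale d i (xs ! Suc i) (h (tens scale ?r))"
    unfolding n1[symmetric] using assms len by (intro insert_id_tens) auto
  also note comm
  also have "insert_at scale d j (xs ! j) (h (tens scale ?r)) =
      insert_id scale d j h (tens scale (take (Suc i) xs @ drop (Suc (Suc i)) xs))"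
    unfolding n2[symmetric] r[symmetric] using assms len by (intro insert_id_tens[symmetric]) auto
  also have "insert_at scale (Suc d) (Suc i) (xs ! Suc i) \<dots> =
      insert_id scale (Suc d) (Suc i) (insert_id scale d j h) (tens scale xs)"
    using assms len by (intro insert_id_tens[symmetric] hij) auto
  finally show "insert_id scale (Suc d) j (insert_id scale d i h) (tens scale xs) =
      insert_id scale (Suc d) (Suc i) (insert_id scale d j h) (tens scale xs)" .
qed


section \<open>Ordered partitions\<close>

definition opart :: "nat \<Rightarrow> nat \<Rightarrow> nat list set"
  where "opart d n = {l. length l = d \<and> sum_list l = n}"

definition degenerate :: "nat list \<Rightarrow> bool"
  where "degenerate l \<longleftrightarrow> (0 < sum_list l \<and> 0 \<in> set l) \<or> (sum_list l = 0 \<and> 1 < length l)"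

definition opart_nd :: "nat \<Rightarrow> nat \<Rightarrow> nat list set"
  where "opart_nd d n = {l \<in> opart d n. \<not> degenerate l}"

definition opart_comp :: "nat list \<Rightarrow> nat \<Rightarrow> nat list \<Rightarrow> nat list"
  where "opart_comp m i l = take i l @ m @ drop (Suc i) l"


section \<open>Differential operators\<close>

type_synonym ('k, 'a) family = "nat list \<Rightarrow> ('k, 'a) tensor \<Rightarrow> ('k, 'a) tensor"

text \<open>
  A family indexed by nondegenerate partitions is set to \<open>0\<close> at all other lists.  Its extension to
  degenerate partitions is computed by removing the leftmost zero; by \<open>extend_insert\<close> below, the
  same rule then holds for a zero at any position.
\<close>

lemma length_takeWhile_nonzero:
  "0 \<in> set l \<Longrightarrow> length (takeWhile (\<lambda>x. x \<noteq> 0) l) < length l"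
  by (induction l) auto

function extend :: "('k::field \<Rightarrow> 'a::ab_group_add \<Rightarrow> 'a) \<Rightarrow> ('k, 'a) family \<Rightarrow> ('k, 'a) family"
  where "extend scale P l =
    (if degenerate l
     then let i = length (takeWhile (\<lambda>x. x \<noteq> 0) l)
          in insert_id scale (length l - 1) i (extend scale P (take i l @ drop (Suc i) l))
     else P l)"
  by auto
termination
proof (relation "measure (\<lambda>(_, _, l). length l)", goal_cases)
  case (2 scale P l i)
  then have "0 \<in> set l"
    by (cases l) (auto simp: degenerate_def)
  then have "i < length l"
    unfolding 2 by (rule length_takeWhile_nonzero)
  then show ?case by auto
qed simp

declare extend.simps [simp del]

lemma extend_degenerate:
  assumes "degenerate l" "i = length (takeWhile (\<lambda>x. x \<noteq> 0) l)" "length l = Suc d"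
  shows "extend scale P l = insert_id scale d i (extend scale P (take i l @ drop (Suc i) l))"
  by (subst extend.simps) (simp only: assms Let_def if_True diff_Suc_1)

definition leibniz :: "('k::field \<Rightarrow> 'a::{ring,monoid_mult} \<Rightarrow> 'a) \<Rightarrow> ('k, 'a) family \<Rightarrow> nat list \<Rightarrow> bool"
  where "leibniz scale P l \<longleftrightarrow>
    (let d = length l in \<forall>i<d. \<forall>xs a a'. length xs = d \<longrightarrow>
      P l (tens scale (xs[i := a * a'])) =
        lmul_at scale d i a (P l (tens scale (xs[i := a']))) +
        rmul_at scale d i a' (P l (tens scale (xs[i := a]))) +
        (\<Sum>m \<in> opart_nd 2 (l ! i). merge_at scale (Suc d) i
           (P (opart_comp m i l) (tens scale (take i xs @ a # a' # drop (Suc i) xs)))))"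

definition diffop :: "('k::field \<Rightarrow> 'a::{ring,monoid_mult} \<Rightarrow> 'a) \<Rightarrow> nat \<Rightarrow> ('k, 'a) family set"
  where "diffop scale n = {P.
    (\<forall>d\<ge>1. \<forall>l \<in> opart_nd d n. P l \<in> thom scale d d) \<and>
    (\<forall>l. l \<notin> (\<Union>d\<in>{1..}. opart_nd d n) \<longrightarrow> P l = 0) \<and>
    (if n = 0 then \<exists>c. P [0] = (\<lambda>t. tscale c (tid scale 1 t))
     else \<forall>d\<ge>1. \<forall>l \<in> opart_nd d n. leibniz scale P l)}"

lemma extend_thom:
  assumes "vector_space scale" "P \<in> diffop scale n" "1 \<le> d" "l \<in> opart d n"
  shows "extend scale P l \<in> thom scale d d"
  using assms(3,4)
proof (induction d arbitrary: l)
  case (Suc d)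
  show ?case
  proof (cases "degenerate l")
    case False
    then show ?thesis
      using assms(2) Suc.prems
      by (subst extend.simps) (auto simp: diffop_def opart_nd_def)
  next
    case True
    define i where "i = length (takeWhile (\<lambda>x. x \<noteq> 0) l)"
    have "0 \<in> set l"
      using True by (cases l) (auto simp: degenerate_def)
    then have i: "i < length l" unfolding i_def by (rule length_takeWhile_nonzero)
    have l0: "l ! i = 0" using i nth_length_takeWhile unfolding i_def by fastforce
    have len: "length l = Suc d" using Suc.prems by (simp add: opart_def)
    have "l = take i l @ 0 # drop (Suc i) l" using i l0 by (metis id_take_nth_drop)
    then have "sum_list l = sum_list (take i l @ drop (Suc i) l)"
      by (metis add_0 sum_list.Cons sum_list.append)
    moreover have "1 \<le> d" using True len Suc.prems
      by (cases l) (auto simp: degenerate_def Suc_le_eq)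
    ultimately have *: "extend scale P (take i l @ drop (Suc i) l) \<in> thom scale d d"
      using Suc i len by (auto simp: opart_def)
    show ?thesis
      unfolding extend_degenerate[OF True i_def len]
      by (rule insert_id_thom[OF assms(1) _ *]) (use i len in simp)
  qed
qed simp

lemma extend_insert:
  assumes "vector_space scale" "P \<in> diffop scale n" "1 \<le> d" "l \<in> opart d n" "i \<le> d"
  shows "extend scale P (take i l @ 0 # drop i l) = insert_id scale d i (extend scale P l)"
  using assms(3-5)
proof (induction d arbitrary: l i)
  case (Suc d)
  have len: "length l = Suc d" and suml: "sum_list l = n" using Suc.prems by (auto simp: opart_def)
  let ?l = "take i l @ 0 # drop i l"
  have "sum_list ?l = n"
    using suml by (metis add_0 append_take_drop_id sum_list.Cons sum_list.append)
  then have deg: "degenerate ?l" using len Suc.prems(3) by (auto simp: degenerate_def)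
  define j where "j = length (takeWhile (\<lambda>x. x \<noteq> 0) ?l)"
  have ext: "extend scale P ?l = insert_id scale (Suc d) j (extend scale P (take j ?l @ drop (Suc j) ?l))"
    by (rule extend_degenerate[OF deg j_def]) (use len Suc.prems(3) in simp)
  show ?case
  proof (cases "0 \<in> set (take i l)")
    case False
    then have "takeWhile (\<lambda>x. x \<noteq> 0) ?l = take i l"
      by (subst takeWhile_append2) (auto intro: gr0I)
    then have "j = i" using len Suc.prems(3) by (simp add: j_def)
    then show ?thesis using ext len Suc.prems(3) by simp
  next
    case True
    then have tw: "takeWhile (\<lambda>x. x \<noteq> 0) ?l = takeWhile (\<lambda>x. x \<noteq> 0) (take i l)"
      by (metis (mono_tags, lifting) takeWhile_append1)
    have ji: "j < i"
      using length_takeWhile_nonzero[OF True] len Suc.prems(3) unfolding j_def tw by simp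
    have jl: "j = length (takeWhile (\<lambda>x. x \<noteq> 0) l)"
      by (metis (mono_tags, lifting) True append_take_drop_id j_def takeWhile_append1 tw)
    have l0: "l ! j = 0"
      using ji len Suc.prems(3) nth_length_takeWhile[of "\<lambda>x. x \<noteq> 0" l] by (simp add: jl)
    show ?thesis
    proof (cases "degenerate l")
      case False
      have "0 \<in> set l" using True by (rule in_set_takeD)
      with False have "sum_list l = 0" "length l \<le> 1" by (auto simp: degenerate_def)
      then have l: "l = [0]" and "n = 0" and d: "d = 0"
        using len suml by (auto simp: length_Suc_conv)
      then have "j = 0" "i = 1" using ji Suc.prems(3) d by auto
      obtain c where c: "P [0] = (\<lambda>t. tscale c (tid scale 1 t))"
        using assms(2) \<open>n = 0\<close> by (auto simp: diffop_def)
      have P0: "P [0] \<in> thom scale 1 1"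
        using assms(2) \<open>n = 0\<close> by (auto simp: diffop_def opart_nd_def opart_def degenerate_def)
      have e0: "extend scale P [0] = P [0]"
        by (subst extend.simps) (simp add: degenerate_def)
      have "insert_id scale 1 0 (P [0]) = insert_id scale 1 1 (P [0])"
      proof (rule thom_eqI)
        show "insert_id scale 1 0 (P [0]) \<in> thom scale 2 2"
          "insert_id scale 1 1 (P [0]) \<in> thom scale 2 2"
          using insert_id_thom[OF assms(1) _ P0] by (auto simp: numeral_2_eq_2)
        fix xs :: "'b list"
        assume "length xs = 2"
        then obtain x y where xs: "xs = [x, y]"
          by (auto simp: numeral_2_eq_2 length_Suc_conv)
        have pw: "tens scale [z] \<in> tensor_power scale 1" for z
          by (rule tens_in_power) simp
        have "insert_at scale 1 k a (tscale c (tens scale [z])) =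
            tscale c (insert_at scale 1 k a (tens scale [z]))" if "k \<le> 1" for k a z
          using insert_at_thom[OF assms(1) that] pw by (simp add: thom_def)
        then show "insert_id scale 1 0 (P [0]) (tens scale xs) = insert_id scale 1 1 (P [0]) (tens scale xs)"
          using insert_id_tens[OF assms(1) _ P0, of 0 xs] insert_id_tens[OF assms(1) _ P0, of 1 xs] pw
            insert_at_tens[OF assms(1), of 0 1] insert_at_tens[OF assms(1), of 1 1]
          by (simp add: xs c tid_def)
      qed
      then show ?thesis using ext \<open>j = 0\<close> \<open>i = 1\<close> l e0 d by simp
    next
      case True
      define m where "m = take j l @ drop (Suc j) l"
      have jlen: "j < length l" using ji len Suc.prems(3) by simp
      have "l = take j l @ 0 # drop (Suc j) l" using jlen l0 by (metis id_take_nth_drop)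
      then have "sum_list m = n"
        using suml unfolding m_def by (metis add_0 sum_list.Cons sum_list.append)
      moreover have "1 \<le> d"
        using True len by (cases l) (auto simp: degenerate_def Suc_le_eq)
      ultimately have m: "m \<in> opart d n" "1 \<le> d"
        using jlen len by (auto simp: m_def opart_def)
      have extl: "extend scale P l = insert_id scale d j (extend scale P m)"
        unfolding m_def by (rule extend_degenerate[OF True jl len])
      have t1: "take j ?l @ drop (Suc j) ?l = take (i - 1) m @ 0 # drop (i - 1) m"
        using insert_remove_list[of j "i - 1" l 0] ji len Suc.prems(3)
        unfolding m_def by (simp del: take_append drop_append)
      have t2: "extend scale P (take (i - 1) m @ 0 # drop (i - 1) m) =
          insert_id scale d (i - 1) (extend scale P m)"
        by (rule Suc.IH[OF m(2,1)]) (use Suc.prems(3) in simp)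
      have t3: "insert_id scale (Suc d) j (insert_id scale d (i - 1) (extend scale P m)) =
          insert_id scale (Suc d) (Suc (i - 1)) (insert_id scale d j (extend scale P m))"
        using ji Suc.prems(3) extend_thom[OF assms(1,2) m(2,1)]
        by (intro insert_id_commute[OF assms(1)]) auto
      have t4: "Suc (i - 1) = i" using ji by simp
      from ext[unfolded t1 t2 t3] show ?thesis unfolding t4 extl[symmetric] .
    qed
  qed
qed simp

definition comp_sum :: "('k::field \<Rightarrow> 'a::ab_group_add \<Rightarrow> 'a) \<Rightarrow> nat \<Rightarrow> nat \<Rightarrow>
    ('k, 'a) family \<Rightarrow> ('k, 'a) family \<Rightarrow> ('k, 'a) family"
  where "comp_sum scale m n Q P l =
    (\<Sum>(l', l'') \<in> {(l', l''). l' \<in> opart (length l) m \<and> l'' \<in> opart (length l) n \<and> map2 (+) l' l'' = l}.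
       extend scale Q l' \<circ> extend scale P l'')"

definition diffop_comp :: "('k::field \<Rightarrow> 'a::ab_group_add \<Rightarrow> 'a) \<Rightarrow> nat \<Rightarrow> nat \<Rightarrow>
    ('k, 'a) family \<Rightarrow> ('k, 'a) family \<Rightarrow> ('k, 'a) family"
  where "diffop_comp scale m n Q P l =
    (if l \<in> (\<Union>d\<in>{1..}. opart_nd d (m + n)) then comp_sum scale m n Q P l else 0)"

text \<open>The direct sum, as the space of finitely supported sequences of homogeneous components.\<close>

definition DA :: "('k::field \<Rightarrow> 'a::{ring,monoid_mult} \<Rightarrow> 'a) \<Rightarrow> (nat \<Rightarrow> ('k, 'a) family) set"
  where "DA scale = {F. (\<forall>n. F n \<in> diffop scale n) \<and> finite {n. F n \<noteq> 0}}"

definition DA_scale :: "'k::field \<Rightarrow> (nat \<Rightarrow> ('k, 'a) family) \<Rightarrow> nat \<Rightarrow> ('k, 'a) family"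
  where "DA_scale c F = (\<lambda>n l t. tscale c (F n l t))"

definition DA_mult :: "('k::field \<Rightarrow> 'a::{ring,monoid_mult} \<Rightarrow> 'a) \<Rightarrow>
    (nat \<Rightarrow> ('k, 'a) family) \<Rightarrow> (nat \<Rightarrow> ('k, 'a) family) \<Rightarrow> nat \<Rightarrow> ('k, 'a) family"
  where "DA_mult scale G F N = (\<Sum>m\<le>N. diffop_comp scale m (N - m) (G m) (F (N - m)))"

definition DA_one :: "('k::field \<Rightarrow> 'a::{ring,monoid_mult} \<Rightarrow> 'a) \<Rightarrow> nat \<Rightarrow> ('k, 'a) family"
  where "DA_one scale n l = (if n = 0 \<and> l = [0] then tid scale 1 else 0)"

end

theory Submission
  imports Defs
begin

text \<open>
  The idea is to forget that degenerate partitions are special.  Extend \<open>P\<close> to all partitions by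
  letting zeros act as identities.  In the Leibniz rule the two boundary terms \<open>a \<cdot>\<^sub>i P\<^sub>\<lambda>(\<dots>, a', \<dots>)\<close>
  and \<open>P\<^sub>\<lambda>(\<dots>, a, \<dots>) \<cdot>\<^sub>i a'\<close> are then the summands \<open>m\<^sup>(\<^sup>i\<^sup>) P\<^bsub>\<mu> \<circ> \<lambda>\<^esub>\<close> for \<open>\<mu> = (0, \<lambda>\<^sub>i)\<close> and \<open>\<mu> = (\<lambda>\<^sub>i, 0)\<close>,
  and the rule becomes an identity of linear maps without exceptional terms,
  \<open>P\<^sub>\<lambda> \<circ> m\<^sup>(\<^sup>i\<^sup>) = (\<Sum>\<kappa>. m\<^sup>(\<^sup>i\<^sup>) \<circ> P\<^sub>\<kappa>)\<close>, summed over all \<open>\<kappa>\<close> that turn into \<open>\<lambda>\<close> when their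
  parts \<open>i\<close> and \<open>i + 1\<close> are added.  Lemma \<open>leibniz_iff\<close> shows that this is the same condition at a
  nondegenerate \<open>\<lambda>\<close> of positive order, and \<open>product_rule_insert_zero\<close> that it persists when zeros are inserted.  So
  operators of order \<open>n\<close> correspond to families on all partitions of \<open>n\<close> with this product rule on
  which zeros act trivially (\<open>extend_total\<close>, \<open>nondeg_part_diffop\<close>, \<open>extend_nondeg_part\<close>), with a
  multiple of the identity at \<open>[0]\<close> if \<open>n = 0\<close>.

  Such families are visibly closed under composition.  Moving \<open>m\<^sup>(\<^sup>i\<^sup>)\<close> to the left, first past
  \<open>P\<close> and then past \<open>Q\<close>, turns \<open>(Q \<circ> P)\<^sub>\<lambda> \<circ> m\<^sup>(\<^sup>i\<^sup>)\<close> into the sum of \<open>m\<^sup>(\<^sup>i\<^sup>) \<circ> Q\<^bsub>\<kappa>'\<^esub> \<circ> P\<^bsub>\<kappa>''\<^esub>\<close>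
  over all pairs for which merging \<open>\<kappa>' + \<kappa>''\<close> gives \<open>\<lambda>\<close>, because merging parts commutes with
  termwise addition of partitions (\<open>sum_decomp_splits\<close>).  A part of \<open>\<lambda>' + \<lambda>''\<close> vanishes only if
  both summands vanish there, so zeros act trivially in the composition as well.  Since a family on
  which zeros act trivially is determined by its nondegenerate part, the composition formula also
  computes the extension of \<open>Q \<circ> P\<close>.  Bilinearity and associativity then reduce to those of
  composition of linear maps, after rearranging a sum over triples of partitions
  (\<open>sum_decomp_assoc\<close>).
\<close>

section \<open>Lists\<close>

text \<open>
  Used with multiplication for the entries of a pure tensor, and with addition for the parts of a
  partition.
\<close>

definition merge_list :: "('x \<Rightarrow> 'x \<Rightarrow> 'x) \<Rightarrow> nat \<Rightarrow> 'x list \<Rightarrow> 'x list"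
  where "merge_list f i xs = take i xs @ f (xs ! i) (xs ! Suc i) # drop (i + 2) xs"

lemma merge_list_append: "length u = i \<Longrightarrow> merge_list f i (u @ a # b # v) = u @ f a b # v"
  by (auto simp: merge_list_def nth_append)

lemma list_split_at:
  assumes "i < length xs"
  obtains u a v where "xs = u @ a # v" "length u = i"
  using assms id_take_nth_drop[OF assms] by (metis length_take min.absorb4)

lemma list_split_at2:
  assumes "Suc i < length xs"
  obtains u a b v where "xs = u @ a # b # v" "length u = i"
proof -
  have "i < length xs" using assms by simp
  then obtain u a w where xs: "xs = u @ a # w" "length u = i"
    by (rule list_split_at)
  with assms obtain b v where "w = b # v" by (cases w) auto
  with xs that show thesis by blast
qed

lemma list_split_le:
  assumes "i \<le> length xs"
  obtains u v where "xs = u @ v" "length u = i"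
  using assms by (metis append_take_drop_id length_take min.absorb2)

lemma sum_fun_apply: "(\<Sum>x\<in>S. f x) y = (\<Sum>x\<in>S. f x y)"
  by (induction S rule: infinite_finite_induct) auto

section \<open>Maps between tensor powers\<close>

locale unital_algebra =
  assoc_algebra_on "UNIV :: 'a set" scale "(*)" 1
  for scale :: "'k::field \<Rightarrow> 'a::{ring,monoid_mult} \<Rightarrow> 'a"
begin

interpretation T: vector_space tscale
  by (rule vector_space_tscale)

abbreviation "pw \<equiv> tensor_power scale"
abbreviation "hom \<equiv> thom scale"

lemma vs: "vector_space scale" by unfold_locales

lemmas pw_subspace = subspace_tensor_power[of scale]
lemmas pw_add = T.subspace_add[OF pw_subspace]
  and pw_scale = T.subspace_scale[OF pw_subspace]
  and pw_zero = T.subspace_0[OF pw_subspace]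
  and pw_sum = T.subspace_sum[OF pw_subspace]

lemma hom_pw: "h \<in> hom d e \<Longrightarrow> t \<in> pw d \<Longrightarrow> h t \<in> pw e"
  by (simp add: thom_def)

lemma hom_add_apply: "h \<in> hom d e \<Longrightarrow> t \<in> pw d \<Longrightarrow> u \<in> pw d \<Longrightarrow> h (t + u) = h t + h u"
  by (simp add: thom_def)

lemma hom_scale_apply: "h \<in> hom d e \<Longrightarrow> t \<in> pw d \<Longrightarrow> h (tscale c t) = tscale c (h t)"
  by (simp add: thom_def)

text \<open>
  Linear maps between tensor powers vanish outside their domain, so the identities below hold as
  equations of functions and can be rewritten with freely.
\<close>

lemma hom_outside: "h \<in> hom d e \<Longrightarrow> t \<notin> pw d \<Longrightarrow> h t = 0"
  by (simp add: thom_def)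

lemma hom_sum_apply:
  assumes "h \<in> hom d e" "\<And>x. x \<in> S \<Longrightarrow> f x \<in> pw d"
  shows "h (\<Sum>x\<in>S. f x) = (\<Sum>x\<in>S. h (f x))"
  using assms(2)
proof (induction S rule: infinite_finite_induct)
  case (insert x S)
  then show ?case
    using hom_add_apply[OF assms(1), of "f x" "sum f S"] pw_sum[of S f d]
    by (simp only: sum.insert insert_iff simp_thms)
qed (simp_all only: sum.infinite sum.empty simp_thms thom_zero[OF assms(1)])

lemma hom_o: "h' \<in> hom e f \<Longrightarrow> h \<in> hom d e \<Longrightarrow> h' \<circ> h \<in> hom d f"
  using thom_comp[of h scale d e h' f] by (simp only: o_def)

lemma hom_zero: "0 \<in> hom d e"
  using pw_zero[of e] by (simp add: thom_def tscale_def fun_eq_iff)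

lemma hom_add:
  assumes "h \<in> hom d e" "h' \<in> hom d e" shows "h + h' \<in> hom d e"
  using assms pw_add[of _ e] by (simp add: thom_def T.scale_right_distrib)

lemma hom_tscale:
  assumes "h \<in> hom d e" shows "(\<lambda>t. tscale c (h t)) \<in> hom d e"
  using assms pw_scale[of _ e] by (simp add: thom_def T.scale_right_distrib T.scale_left_commute mult.commute)

lemma hom_sum: "(\<And>x. x \<in> S \<Longrightarrow> f x \<in> hom d e) \<Longrightarrow> (\<Sum>x\<in>S. f x) \<in> hom d e"
proof (induction S rule: infinite_finite_induct)
  case (insert x S)
  then show ?case using hom_add[of "f x" d e "sum f S"] by (simp only: sum.insert insert_iff simp_thms)
qed (simp_all only: sum.infinite sum.empty simp_thms hom_zero)

lemma tid_hom: "tid scale d \<in> hom d d"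
  using pw_add[of _ d] pw_scale[of _ d] by (simp add: thom_def tid_def)

lemma tid_o: "h \<in> hom d e \<Longrightarrow> tid scale e \<circ> h = h"
  by (rule ext) (metis hom_pw hom_outside pw_zero tid_def o_apply)

lemma o_tid: "h \<in> hom d e \<Longrightarrow> h \<circ> tid scale d = h"
  by (rule ext) (metis thom_zero hom_outside tid_def o_apply)

lemma o_sum_hom:
  assumes "h \<in> hom e e'" "\<And>x. x \<in> S \<Longrightarrow> f x \<in> hom d e"
  shows "h \<circ> (\<Sum>x\<in>S. f x) = (\<Sum>x\<in>S. h \<circ> f x)"
proof
  fix t
  have "f x t \<in> pw e" if "x \<in> S" for x
    using assms(2)[OF that] hom_pw hom_outside pw_zero by (cases "t \<in> pw d") metis+
  then show "(h \<circ> (\<Sum>x\<in>S. f x)) t = (\<Sum>x\<in>S. h \<circ> f x) t"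
    using hom_sum_apply[OF assms(1), of S "\<lambda>x. f x t"] by (simp only: sum_fun_apply o_apply)
qed

lemma sum_o: "(\<Sum>x\<in>S. f x) \<circ> h = (\<Sum>x\<in>S. f x \<circ> h)"
  by (rule ext) (simp only: sum_fun_apply o_apply)

lemma o_add_hom:
  assumes "h \<in> hom e e'" "f \<in> hom d e" "g \<in> hom d e"
  shows "h \<circ> (f + g) = (h \<circ> f) + (h \<circ> g)"
proof
  fix t
  have "f t \<in> pw e" "g t \<in> pw e"
    using assms hom_pw hom_outside pw_zero by (cases "t \<in> pw d"; metis)+
  then show "(h \<circ> (f + g)) t = ((h \<circ> f) + (h \<circ> g)) t"
    using hom_add_apply[OF assms(1)] by (simp only: plus_fun_apply o_apply)
qed

lemma o_tscale_hom:
  assumes "h \<in> hom e e'" "f \<in> hom d e"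
  shows "h \<circ> (\<lambda>t. tscale c (f t)) = (\<lambda>t. tscale c ((h \<circ> f) t))"
proof
  fix t
  have "f t \<in> pw e"
    using assms hom_pw hom_outside pw_zero by (cases "t \<in> pw d"; metis)
  then show "(h \<circ> (\<lambda>t. tscale c (f t))) t = tscale c ((h \<circ> f) t)"
    using hom_scale_apply[OF assms(1)] by (simp only: o_apply)
qed

section \<open>Multiplying neighbours and inserting a factor\<close>

lemma linear_tens_update:
  assumes "Vector_Spaces.linear scale scale g" "j < length xs"
  shows "Vector_Spaces.linear scale tscale (\<lambda>a. tens scale (xs[j := g a]))"
proof -
  have "Vector_Spaces.linear scale tscale (\<lambda>a. tens scale (xs[j := a]))"
    using multilinear_tens[OF vs, of "length xs"] assms(2) unfolding multilinear_def by blast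
  from Vector_Spaces.linear_compose[OF assms(1) this] show ?thesis by (simp add: o_def)
qed

lemma linear_mult:
  "Vector_Spaces.linear scale scale (\<lambda>a. a)"
  "Vector_Spaces.linear scale scale (\<lambda>a. a * b)"
  "Vector_Spaces.linear scale scale (\<lambda>a. b * a)"
  using vs scale_mul mul_scale by (auto simp: Vector_Spaces.linear_iff algebra_simps)

text \<open>
  Changing one entry of a list changes a single entry of the merged list, by the identity or by a
  one-sided multiplication, and these are linear.
\<close>

lemma multilinear_merge:
  assumes "i < d"
  shows "multilinear scale tscale (Suc d) (\<lambda>xs. tens scale (merge_list (*) i xs))"
  unfolding multilinear_def
proof (intro allI impI)
  fix xs :: "'a list" and j
  assume len: "length xs = Suc d" and j: "j < Suc d"
  have "Suc i < length xs" using assms len by simp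
  then obtain u a b v where xs: "xs = u @ a # b # v" and u: "length u = i"
    by (rule list_split_at2)
  let ?L = "u @ a * b # v"
  have "\<exists>g j'. Vector_Spaces.linear scale scale g \<and> j' < length ?L \<and>
      (\<forall>x. merge_list (*) i (xs[j := x]) = ?L[j' := g x])"
  proof -
    consider "j < i" | "j = i" | "j = Suc i" | "Suc i < j"
      by linarith
    then show ?thesis
    proof cases
      case 1
      then show ?thesis
        by (intro exI[of _ "\<lambda>x. x"] exI[of _ j])
          (use u in \<open>auto simp: xs list_update_append merge_list_append linear_mult\<close>)
    next
      case 2
      then show ?thesis
        by (intro exI[of _ "\<lambda>x. x * b"] exI[of _ i])
          (use u in \<open>auto simp: xs list_update_append merge_list_append linear_mult\<close>)
    next
      case 3
      then show ?thesis
        by (intro exI[of _ "\<lambda>x. a * x"] exI[of _ i])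
          (use u in \<open>auto simp: xs list_update_append merge_list_append linear_mult\<close>)
    next
      case 4
      then obtain k where k: "j = Suc (Suc (i + k))"
        using less_imp_Suc_add[of "Suc i" j] by auto
      then show ?thesis
        using j len by (intro exI[of _ "\<lambda>x. x"] exI[of _ "Suc (i + k)"])
          (use u in \<open>auto simp: xs list_update_append merge_list_append linear_mult\<close>)
    qed
  qed
  then show "Vector_Spaces.linear scale tscale (\<lambda>x. tens scale (merge_list (*) i (xs[j := x])))"
    using linear_tens_update by auto
qed

text \<open>
  The index is the number of factors of the value, so that \<open>mrg d i\<close> and
  \<open>insert_at scale d j a\<close> go back and forth between the same two spaces.
\<close>

abbreviation "mrg d \<equiv> merge_at scale (Suc d)"

lemma mrg_eq: "mrg d i = tlift scale (Suc d) (\<lambda>xs. tens scale (merge_list (*) i xs))"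
  by (simp add: merge_at_def merge_list_def)

lemma mrg_tens:
  assumes "length u = i" "d = Suc (length u + length v)"
  shows "mrg d i (tens scale (u @ a # b # v)) = tens scale (u @ a * b # v)"
  using assms tlift_tens[OF multilinear_merge[of i d], of "u @ a # b # v"]
  by (simp add: mrg_eq merge_list_append)

lemma mrg_hom: "i < d \<Longrightarrow> mrg d i \<in> hom (Suc d) d"
  unfolding mrg_eq by (rule tlift_thom[OF multilinear_merge]) (auto simp: merge_list_def intro!: tens_in_power)

abbreviation "ins \<equiv> insert_at scale"
abbreviation "iid \<equiv> insert_id scale"

lemma ins_tens:
  assumes "length u = i" "d = length u + length v"
  shows "ins d i a (tens scale (u @ v)) = tens scale (u @ a # v)"
  using assms by (simp add: insert_at_tens[OF vs])

lemma ins_hom: "i \<le> d \<Longrightarrow> ins d i a \<in> hom d (Suc d)"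
  by (rule insert_at_thom[OF vs])

lemma iid_hom: "i \<le> d \<Longrightarrow> h \<in> hom d d \<Longrightarrow> iid d i h \<in> hom (Suc d) (Suc d)"
  by (rule insert_id_thom[OF vs])

text \<open>
  The definition of \<^const>\<open>insert_id\<close>, with an arbitrary tensor in place of a pure one.  Since the
  tensors with a factor inserted at a given place span (\<open>hom_eqI_ins\<close>), this equation characterises
  \<^const>\<open>insert_id\<close> and yields its algebraic properties.
\<close>

lemma iid_ins:
  assumes "i \<le> d" "h \<in> hom d d" "t \<in> pw d"
  shows "iid d i h (ins d i a t) = ins d i a (h t)"
proof -
  have "iid d i h \<circ> ins d i a = ins d i a \<circ> h"
  proof (rule thom_eqI)
    show "iid d i h \<circ> ins d i a \<in> hom d (Suc d)" "ins d i a \<circ> h \<in> hom d (Suc d)"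
      using assms by (auto intro!: hom_o iid_hom ins_hom)
    fix xs :: "'a list" assume len: "length xs = d"
    have "i \<le> length xs" using assms len by simp
    then obtain u v where "xs = u @ v" "length u = i"
      by (rule list_split_le)
    then show "(iid d i h \<circ> ins d i a) (tens scale xs) = (ins d i a \<circ> h) (tens scale xs)"
      using assms len by (simp add: ins_tens insert_id_tens[OF vs] nth_append)
  qed
  then show ?thesis by (metis o_apply)
qed

lemma hom_eqI_ins:
  assumes "g \<in> hom (Suc d) e" "g' \<in> hom (Suc d) e" "i \<le> d"
    and eq: "\<And>a t. t \<in> pw d \<Longrightarrow> g (ins d i a t) = g' (ins d i a t)"
  shows "g = g'"
proof (rule thom_eqI[OF assms(1,2)])
  fix xs :: "'a list" assume len: "length xs = Suc d"
  have "i < length xs" using assms len by simp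
  then obtain u a v where xs: "xs = u @ a # v" "length u = i"
    by (rule list_split_at)
  then have "tens scale xs = ins d i a (tens scale (u @ v))"
    using len by (simp add: ins_tens)
  then show "g (tens scale xs) = g' (tens scale xs)"
    using eq[of "tens scale (u @ v)" a] len xs by (simp add: tens_in_power)
qed

lemma iid_o:
  assumes "i \<le> d" "h \<in> hom d d" "h' \<in> hom d d"
  shows "iid d i (h \<circ> h') = iid d i h \<circ> iid d i h'"
  by (rule hom_eqI_ins[of _ d "Suc d" _ i])
    (use assms in \<open>auto intro!: hom_o iid_hom simp: iid_ins hom_o hom_pw\<close>)

lemma iid_add:
  assumes "i \<le> d" "h \<in> hom d d" "h' \<in> hom d d"
  shows "iid d i (h + h') = iid d i h + iid d i h'"
proof (rule hom_eqI_ins[of _ d "Suc d" _ i])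
  fix a t assume "t \<in> pw d"
  then show "iid d i (h + h') (ins d i a t) = (iid d i h + iid d i h') (ins d i a t)"
    using assms hom_add[OF assms(2,3)] hom_add_apply[OF ins_hom[of i d a]]
    by (simp add: iid_ins hom_pw plus_fun_def[of h h'] plus_fun_def[of "iid d i h"])
qed (use assms in \<open>auto intro!: hom_add iid_hom\<close>)

lemma iid_tscale:
  assumes "i \<le> d" "h \<in> hom d d"
  shows "iid d i (\<lambda>t. tscale c (h t)) = (\<lambda>t. tscale c (iid d i h t))"
proof (rule hom_eqI_ins[of _ d "Suc d" _ i])
  fix a t assume "t \<in> pw d"
  then show "iid d i (\<lambda>t. tscale c (h t)) (ins d i a t) = tscale c (iid d i h (ins d i a t))"
    using assms hom_tscale[OF assms(2)] hom_scale_apply[OF ins_hom[of i d a]]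
    by (simp add: iid_ins hom_pw)
qed (use assms in \<open>auto intro!: hom_tscale iid_hom\<close>)

lemma iid_zero:
  assumes "i \<le> d" shows "iid d i 0 = 0"
proof -
  have "iid d i 0 + iid d i 0 = iid d i 0"
    using iid_add[OF assms hom_zero hom_zero] by (metis add_0)
  then show ?thesis by (metis add_cancel_right_right)
qed

lemma iid_sum:
  assumes "i \<le> d" "\<And>x. x \<in> S \<Longrightarrow> f x \<in> hom d d"
  shows "iid d i (\<Sum>x\<in>S. f x) = (\<Sum>x\<in>S. iid d i (f x))"
  using assms(2)
proof (induction S rule: infinite_finite_induct)
  case (insert x S)
  then show ?case
    using iid_add[OF assms(1), of "f x" "sum f S"] hom_sum[of S f d d]
    by (simp only: sum.insert insert_iff simp_thms)
qed (simp_all only: sum.infinite sum.empty simp_thms iid_zero[OF assms(1)])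

lemma iid_tid: 
  assumes "i \<le> d" shows "iid d i (tid scale d) = tid scale (Suc d)"
proof (rule hom_eqI_ins[of _ d "Suc d" _ i])
  fix a t assume "t \<in> pw d"
  then show "iid d i (tid scale d) (ins d i a t) = tid scale (Suc d) (ins d i a t)"
    using assms hom_pw[OF ins_hom[OF assms]] by (simp add: iid_ins tid_hom) (simp add: tid_def)
qed (use assms in \<open>auto intro!: tid_hom iid_hom\<close>)

text \<open>
  Two inserted neighbours are multiplied with each other; an inserted factor that is not involved
  in the multiplication can be inserted afterwards, with its position shifted if it stands to the
  right.
\<close>

lemma mrg_ins_ins:
  assumes "i \<le> d" "t \<in> pw d"
  shows "mrg (Suc d) i (ins (Suc d) i a (ins d i b t)) = ins d i (a * b) t"
proof -
  have "mrg (Suc d) i \<circ> (ins (Suc d) i a \<circ> ins d i b) = ins d i (a * b)"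
  proof (rule thom_eqI)
    show "mrg (Suc d) i \<circ> (ins (Suc d) i a \<circ> ins d i b) \<in> hom d (Suc d)" "ins d i (a * b) \<in> hom d (Suc d)"
      using assms by (simp_all add: hom_o[OF mrg_hom hom_o[OF ins_hom ins_hom]] ins_hom)
    fix xs :: "'a list" assume len: "length xs = d"
    have "i \<le> length xs" using assms len by simp
    then obtain u v where "xs = u @ v" "length u = i"
      by (rule list_split_le)
    then show "(mrg (Suc d) i \<circ> (ins (Suc d) i a \<circ> ins d i b)) (tens scale xs) = ins d i (a * b) (tens scale xs)"
      using len by (simp add: ins_tens mrg_tens)
  qed
  then show ?thesis by (metis o_apply)
qed

lemma mrg_ins_before:
  assumes "j \<le> i" "i < d" "t \<in> pw (Suc d)"
  shows "mrg (Suc d) (Suc i) (ins (Suc d) j x t) = ins d j x (mrg d i t)"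
proof -
  have "mrg (Suc d) (Suc i) \<circ> ins (Suc d) j x = ins d j x \<circ> mrg d i"
  proof (rule thom_eqI)
    show "mrg (Suc d) (Suc i) \<circ> ins (Suc d) j x \<in> hom (Suc d) (Suc d)" "ins d j x \<circ> mrg d i \<in> hom (Suc d) (Suc d)"
      using assms by (simp_all add: hom_o[OF mrg_hom ins_hom] hom_o[OF ins_hom mrg_hom])
    fix xs :: "'a list" assume len: "length xs = Suc d"
    have "Suc i < length xs" using assms len by simp
    then obtain w a b v where xs: "xs = w @ a # b # v" "length w = i"
      by (rule list_split_at2)
    have "j \<le> length w" using assms xs by simp
    then obtain u w' where w: "w = u @ w'" "length u = j"
      by (rule list_split_le)
    show "(mrg (Suc d) (Suc i) \<circ> ins (Suc d) j x) (tens scale xs) = (ins d j x \<circ> mrg d i) (tens scale xs)"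
      using len xs w ins_tens[of u j "Suc d" "w' @ a # b # v" x] mrg_tens[of "u @ x # w'" "Suc i" "Suc d" v a b]
        mrg_tens[of "u @ w'" i d v a b] ins_tens[of u j d "w' @ a * b # v" x] by simp
  qed
  then show ?thesis by (metis o_apply)
qed

lemma mrg_ins_after:
  assumes "i < j" "j \<le> d" "t \<in> pw (Suc d)"
  shows "mrg (Suc d) i (ins (Suc d) (Suc j) x t) = ins d j x (mrg d i t)"
proof -
  have "mrg (Suc d) i \<circ> ins (Suc d) (Suc j) x = ins d j x \<circ> mrg d i"
  proof (rule thom_eqI)
    show "mrg (Suc d) i \<circ> ins (Suc d) (Suc j) x \<in> hom (Suc d) (Suc d)" "ins d j x \<circ> mrg d i \<in> hom (Suc d) (Suc d)"
      using assms by (simp_all add: hom_o[OF mrg_hom ins_hom] hom_o[OF ins_hom mrg_hom])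
    fix xs :: "'a list" assume len: "length xs = Suc d"
    have "Suc i < length xs" using assms len by simp
    then obtain u a b w where xs: "xs = u @ a # b # w" "length u = i"
      by (rule list_split_at2)
    have "j - Suc i \<le> length w" using assms xs len by simp
    then obtain w' v where w: "w = w' @ v" "length w' = j - Suc i"
      by (rule list_split_le)
    show "(mrg (Suc d) i \<circ> ins (Suc d) (Suc j) x) (tens scale xs) = (ins d j x \<circ> mrg d i) (tens scale xs)"
      using assms len xs w ins_tens[of "u @ a # b # w'" "Suc j" "Suc d" v x] mrg_tens[of u i "Suc d" "w' @ x # v" a b]
        mrg_tens[of u i d w a b] ins_tens[of "u @ a * b # w'" j d v x] by simp
  qed
  then show ?thesis by (metis o_apply)
qed

lemma multilinear_lmul_rmul:
  assumes "i < d"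
  shows "multilinear scale tscale d (\<lambda>xs. tens scale (xs[i := a * xs ! i]))"
    and "multilinear scale tscale d (\<lambda>xs. tens scale (xs[i := xs ! i * a]))"
proof -
  have lin: "Vector_Spaces.linear scale tscale (\<lambda>x. tens scale ((xs[j := x])[i := g (xs[j := x] ! i)]))"
    if "length xs = d" "j < d" "Vector_Spaces.linear scale scale g" for xs j g
  proof (cases "j = i")
    case True
    then show ?thesis using that linear_tens_update[of g i xs] by simp
  next
    case False
    then show ?thesis
      using that linear_tens_update[OF linear_mult(1), of j "xs[i := g (xs ! i)]"]
      by (simp add: list_update_swap[of j i])
  qed
  show "multilinear scale tscale d (\<lambda>xs. tens scale (xs[i := a * xs ! i]))"
    "multilinear scale tscale d (\<lambda>xs. tens scale (xs[i := xs ! i * a]))"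
    unfolding multilinear_def using lin linear_mult(2,3) by blast+
qed

text \<open>
  A one-sided multiplication inserts the factor next to the \<open>i\<close>-th one and multiplies the two.  In
  this form the boundary terms of the Leibniz rule can be compared with its other summands.
\<close>

lemma lmul_at_eq:
  assumes "i < d" shows "lmul_at scale d i a = mrg d i \<circ> ins d i a"
proof (rule thom_eqI)
  show "lmul_at scale d i a \<in> hom d d" unfolding lmul_at_def
    by (rule tlift_thom[OF multilinear_lmul_rmul(1)[OF assms]]) (auto intro: tens_in_power)
  show "mrg d i \<circ> ins d i a \<in> hom d d"
    using assms by (auto intro!: hom_o[of _ "Suc d"] mrg_hom ins_hom)
  fix xs :: "'a list" assume len: "length xs = d"
  have "i < length xs" using assms len by simp
  then obtain u x v where xs: "xs = u @ x # v" "length u = i"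
    by (rule list_split_at)
  show "lmul_at scale d i a (tens scale xs) = (mrg d i \<circ> ins d i a) (tens scale xs)"
    unfolding lmul_at_def using xs len
    by (simp add: tlift_tens[OF multilinear_lmul_rmul(1)[OF assms]] ins_tens mrg_tens list_update_append nth_append)
qed

lemma rmul_at_eq:
  assumes "i < d" shows "rmul_at scale d i a = mrg d i \<circ> ins d (Suc i) a"
proof (rule thom_eqI)
  show "rmul_at scale d i a \<in> hom d d" unfolding rmul_at_def
    by (rule tlift_thom[OF multilinear_lmul_rmul(2)[OF assms]]) (auto intro: tens_in_power)
  show "mrg d i \<circ> ins d (Suc i) a \<in> hom d d"
    using assms by (auto intro!: hom_o[of _ "Suc d"] mrg_hom ins_hom)
  fix xs :: "'a list" assume len: "length xs = d"
  have "i < length xs" using assms len by simp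
  then obtain u x v where xs: "xs = u @ x # v" "length u = i"
    by (rule list_split_at)
  show "rmul_at scale d i a (tens scale xs) = (mrg d i \<circ> ins d (Suc i) a) (tens scale xs)"
    unfolding rmul_at_def using xs len ins_tens[of "u @ [x]" "Suc i" d v a]
    by (simp add: tlift_tens[OF multilinear_lmul_rmul(2)[OF assms]] mrg_tens list_update_append nth_append)
qed


end

section \<open>Families of operators\<close>

text \<open>
  These are the partitions obtained by splitting the \<open>i\<close>-th part in two, with \<open>0\<close> allowed.
  Describing them by what they merge to makes their compatibility with termwise addition immediate.
\<close>

definition splits :: "nat \<Rightarrow> nat list \<Rightarrow> nat list set"
  where "splits i l = {k. length k = Suc (length l) \<and> merge_list (+) i k = l}"

lemma splits_append:
  assumes "length u = i"
  shows "splits i (u @ n # v) = (\<lambda>p. u @ p # (n - p) # v) ` {..n}"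
proof
  show "splits i (u @ n # v) \<subseteq> (\<lambda>p. u @ p # (n - p) # v) ` {..n}"
  proof
    fix k assume k: "k \<in> splits i (u @ n # v)"
    then have "Suc i < length k" using assms by (simp add: splits_def)
    then obtain u' a b v' where k': "k = u' @ a # b # v'" "length u' = i"
      by (rule list_split_at2)
    then have "u' = u" "a + b = n" "v' = v"
      using k assms by (auto simp: splits_def merge_list_append)
    with k' show "k \<in> (\<lambda>p. u @ p # (n - p) # v) ` {..n}"
      by (intro image_eqI[of _ _ a]) auto
  qed
qed (use assms in \<open>auto simp: splits_def merge_list_append\<close>)

lemma sum_splits:
  assumes "length u = i"
  shows "(\<Sum>k\<in>splits i (u @ n # v). g k) = (\<Sum>p\<le>n. g (u @ p # (n - p) # v))"
  unfolding splits_append[OF assms] by (subst sum.reindex) (auto simp: inj_on_def)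

lemma splits_finite:
  assumes "i < length l" shows "finite (splits i l)"
proof -
  obtain u n v where "l = u @ n # v" "length u = i"
    using assms by (rule list_split_at)
  then show ?thesis by (simp add: splits_append)
qed

lemma sum_list_merge: "Suc i < length k \<Longrightarrow> sum_list (merge_list (+) i k) = sum_list (k :: nat list)"
  by (erule list_split_at2) (simp add: merge_list_append)

context unital_algebra
begin

definition nondeg :: "nat \<Rightarrow> nat list \<Rightarrow> bool"
  where "nondeg n l \<longleftrightarrow> l \<noteq> [] \<and> sum_list l = n \<and> \<not> degenerate l"

lemma nondeg_iff: "l \<in> (\<Union>d\<in>{1..}. opart_nd d n) \<longleftrightarrow> nondeg n l"
  by (cases l) (auto simp: opart_nd_def opart_def nondeg_def)

definition endo :: "nat \<Rightarrow> ('k, 'a) family \<Rightarrow> bool"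
  where "endo n F \<longleftrightarrow> (\<forall>l. l \<noteq> [] \<longrightarrow> sum_list l = n \<longrightarrow> F l \<in> hom (length l) (length l))"

definition zeros_act_trivially :: "nat \<Rightarrow> ('k, 'a) family \<Rightarrow> bool"
  where "zeros_act_trivially n F \<longleftrightarrow> (\<forall>u v. u @ v \<noteq> [] \<longrightarrow> sum_list (u @ v) = n \<longrightarrow>
    F (u @ 0 # v) = iid (length (u @ v)) (length u) (F (u @ v)))"

text \<open>
  The Leibniz rule at factor \<open>i\<close>; the splittings that involve a \<open>0\<close> supply its boundary terms.
\<close>

definition product_rule :: "('k, 'a) family \<Rightarrow> nat list \<Rightarrow> nat \<Rightarrow> bool"
  where "product_rule F l i \<longleftrightarrow>
    F l \<circ> mrg (length l) i = (\<Sum>k\<in>splits i l. mrg (length l) i \<circ> F k)"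

text \<open>
  An operator of order \<open>n\<close> as a family on all partitions: these are the extensions of the elements
  of \<^term>\<open>diffop scale n\<close>, by \<open>extend_total\<close> and \<open>nondeg_part_diffop\<close>.
\<close>

definition total_diffop :: "nat \<Rightarrow> ('k, 'a) family \<Rightarrow> bool"
  where "total_diffop n F \<longleftrightarrow> endo n F \<and> zeros_act_trivially n F \<and>
    (\<forall>l i. sum_list l = n \<longrightarrow> i < length l \<longrightarrow> product_rule F l i) \<and>
    (n = 0 \<longrightarrow> (\<exists>c. F [0] = (\<lambda>t. tscale c (tid scale 1 t))))"

lemma endoD: "endo n F \<Longrightarrow> l \<noteq> [] \<Longrightarrow> sum_list l = n \<Longrightarrow> length l = d \<Longrightarrow> F l \<in> hom d d"
  by (auto simp: endo_def)

lemma zerosD: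
  "zeros_act_trivially n F \<Longrightarrow> u @ v \<noteq> [] \<Longrightarrow> sum_list (u @ v) = n \<Longrightarrow> length (u @ v) = d \<Longrightarrow>
    length u = i \<Longrightarrow> F (u @ 0 # v) = iid d i (F (u @ v))"
  by (auto simp: zeros_act_trivially_def)

lemma splits_endo:
  assumes "endo n F" "sum_list l = n" "i < length l" "k \<in> splits i l"
  shows "F k \<in> hom (Suc (length l)) (Suc (length l))"
  using assms sum_list_merge[of i k] by (intro endoD[OF assms(1)]) (auto simp: splits_def)

lemma product_rule_iff:
  assumes F: "endo n F" and l: "sum_list l = n" "i < length l"
  shows "product_rule F l i \<longleftrightarrow> (\<forall>us a b vs. length us = i \<longrightarrow> Suc (i + length vs) = length l \<longrightarrow>
    F l (tens scale (us @ a * b # vs)) =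
    (\<Sum>k\<in>splits i l. mrg (length l) i (F k (tens scale (us @ a # b # vs)))))"
    (is "_ \<longleftrightarrow> ?R")
proof
  assume pr: "product_rule F l i"
  show ?R
  proof (intro allI impI)
    fix us vs :: "'a list" and a b
    assume len: "length us = i" "Suc (i + length vs) = length l"
    have "F l (tens scale (us @ a * b # vs)) = (F l \<circ> mrg (length l) i) (tens scale (us @ a # b # vs))"
      using len by (simp add: mrg_tens)
    also have "\<dots> = (\<Sum>k\<in>splits i l. mrg (length l) i (F k (tens scale (us @ a # b # vs))))"
      using pr unfolding product_rule_def by (simp only: sum_fun_apply o_apply)
    finally show "F l (tens scale (us @ a * b # vs)) =
      (\<Sum>k\<in>splits i l. mrg (length l) i (F k (tens scale (us @ a # b # vs))))" .
  qed
next
  assume R: ?R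
  have "F l \<in> hom (length l) (length l)" using F l by (intro endoD) auto
  show "product_rule F l i"
    unfolding product_rule_def
  proof (rule thom_eqI)
    show "F l \<circ> mrg (length l) i \<in> hom (Suc (length l)) (length l)"
      using hom_o[OF \<open>F l \<in> _\<close> mrg_hom[OF l(2)]] .
    show "(\<Sum>k\<in>splits i l. mrg (length l) i \<circ> F k) \<in> hom (Suc (length l)) (length l)"
      by (rule hom_sum, rule hom_o[OF mrg_hom[OF l(2)] splits_endo[OF F l]])
    fix xs :: "'a list" assume len: "length xs = Suc (length l)"
    then have "Suc i < length xs" using l by simp
    then obtain us a b vs where xs: "xs = us @ a # b # vs" "length us = i"
      by (rule list_split_at2)
    have "(F l \<circ> mrg (length l) i) (tens scale xs) = F l (tens scale (us @ a * b # vs))"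
      using xs len by (simp add: mrg_tens)
    also have "\<dots> = (\<Sum>k\<in>splits i l. mrg (length l) i (F k (tens scale xs)))"
      using R xs len by simp
    also have "\<dots> = (\<Sum>k\<in>splits i l. mrg (length l) i \<circ> F k) (tens scale xs)"
      by (simp only: sum_fun_apply o_apply)
    finally show "(F l \<circ> mrg (length l) i) (tens scale xs) =
      (\<Sum>k\<in>splits i l. mrg (length l) i \<circ> F k) (tens scale xs)" .
  qed
qed

lemma sum_opart_nd_2:
  assumes "0 < k"
  shows "(\<Sum>m\<in>opart_nd 2 k. h m) = (\<Sum>p\<in>{0<..<k}. h [p, k - p])"
proof (rule sum.reindex_bij_witness[where i = "\<lambda>p. [p, k - p]" and j = hd])
  fix m assume "m \<in> opart_nd 2 k"
  then obtain p q where "m = [p, q]" "p + q = k" "0 < p" "0 < q"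
    using assms by (auto simp: opart_nd_def opart_def degenerate_def numeral_2_eq_2 length_Suc_conv)
  then show "[hd m, k - hd m] = m" "hd m \<in> {0<..<k}" "h [hd m, k - hd m] = h m" by auto
qed (use assms in \<open>auto simp: opart_nd_def opart_def degenerate_def\<close>)

text \<open>
  The splittings of \<open>m\<close> as \<open>0 + m\<close> and \<open>m + 0\<close> give the one-sided multiplications, because \<open>F\<close> acts
  as the identity on the factor that belongs to the \<open>0\<close>.  For \<open>m > 0\<close> these two are distinct, and
  the others are the nondegenerate ones.
\<close>

lemma product_expansion:
  assumes F: "endo n F" "zeros_act_trivially n F"
    and l: "l = u @ m # v" "length u = i" "sum_list l = n" "0 < m"
    and len: "length us = i" "length vs = length v" and d: "d = length l"
  shows "(\<Sum>k\<in>splits i l. mrg d i (F k (tens scale (us @ a # b # vs)))) =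
    lmul_at scale d i a (F l (tens scale (us @ b # vs))) +
    rmul_at scale d i b (F l (tens scale (us @ a # vs))) +
    (\<Sum>p\<in>opart_nd 2 m. mrg d i (F (opart_comp p i l) (tens scale (us @ a # b # vs))))"
proof -
  let ?g = "\<lambda>p. mrg d i (F (u @ p # (m - p) # v) (tens scale (us @ a # b # vs)))"
  have id: "i < d" using d l by simp
  have Fl: "F l \<in> hom d d" using F(1) l d by (intro endoD) auto
  have split: "{..m} = insert 0 (insert m {0<..<m})" using l(4) by auto
  have "(\<Sum>k\<in>splits i l. mrg d i (F k (tens scale (us @ a # b # vs)))) = (\<Sum>p\<le>m. ?g p)"
    unfolding l(1) by (rule sum_splits[OF l(2)])
  also have "\<dots> = ?g 0 + ?g m + (\<Sum>p\<in>{0<..<m}. ?g p)"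
    unfolding split using l(4) by (simp add: add.assoc)
  also have "?g 0 = lmul_at scale d i a (F l (tens scale (us @ b # vs)))"
  proof -
    have "F (u @ 0 # m # v) = iid d i (F l)"
      using zerosD[OF F(2), of u "m # v" d i] l d by simp
    moreover have "tens scale (us @ a # b # vs) = ins d i a (tens scale (us @ b # vs))"
      using len l d by (simp add: ins_tens)
    moreover have "tens scale (us @ b # vs) \<in> pw d"
      using len l d by (intro tens_in_power) simp
    ultimately show ?thesis
      using id by (simp only: iid_ins[OF _ Fl] lmul_at_eq[OF id] o_apply less_imp_le Suc_leI
        diff_zero diff_self_eq_0)
  qed
  also have "?g m = rmul_at scale d i b (F l (tens scale (us @ a # vs)))"
  proof -
    have "F (u @ m # 0 # v) = iid d (Suc i) (F l)"
      using zerosD[OF F(2), of "u @ [m]" v d "Suc i"] l d by simp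
    moreover have "tens scale (us @ a # b # vs) = ins d (Suc i) b (tens scale (us @ a # vs))"
      using len l d ins_tens[of "us @ [a]" "Suc i" d vs b] by simp
    moreover have "tens scale (us @ a # vs) \<in> pw d"
      using len l d by (intro tens_in_power) simp
    ultimately show ?thesis
      using id by (simp only: iid_ins[OF _ Fl] rmul_at_eq[OF id] o_apply less_imp_le Suc_leI
        diff_zero diff_self_eq_0)
  qed
  also have "(\<Sum>p\<in>{0<..<m}. ?g p) =
      (\<Sum>p\<in>opart_nd 2 m. mrg d i (F (opart_comp p i l) (tens scale (us @ a # b # vs))))"
    unfolding sum_opart_nd_2[OF l(4)] by (rule sum.cong) (use l in \<open>auto simp: opart_comp_def\<close>)
  finally show ?thesis .
qed

lemma opart_comp_nondeg:
  assumes "nondeg n l" "0 < n" "i < length l" "p \<in> opart_nd 2 (l ! i)"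
  shows "nondeg n (opart_comp p i l)"
proof -
  obtain u m v where l: "l = u @ m # v" "length u = i"
    using assms(3) by (rule list_split_at)
  have "0 \<notin> set l" using assms(1,2) by (auto simp: nondeg_def degenerate_def simp del: sum_list_eq_0_iff)
  then show ?thesis
    using assms l by (auto simp: nondeg_def degenerate_def opart_comp_def opart_nd_def opart_def)
qed

lemma leibniz_iff:
  assumes F: "endo n F" "zeros_act_trivially n F" and FP: "\<And>l. nondeg n l \<Longrightarrow> F l = P l"
    and l: "nondeg n l" and n: "0 < n"
  shows "leibniz scale P l \<longleftrightarrow> (\<forall>i<length l. product_rule F l i)"
proof -
  define d where "d = length l"
  have suml: "sum_list l = n" and l0: "0 \<notin> set l"
    using l n by (auto simp: nondeg_def degenerate_def simp del: sum_list_eq_0_iff)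
  have "(\<forall>xs a a'. length xs = d \<longrightarrow>
      P l (tens scale (xs[i := a * a'])) =
        lmul_at scale d i a (P l (tens scale (xs[i := a']))) +
        rmul_at scale d i a' (P l (tens scale (xs[i := a]))) +
        (\<Sum>m \<in> opart_nd 2 (l ! i). mrg d i
           (P (opart_comp m i l) (tens scale (take i xs @ a # a' # drop (Suc i) xs))))) \<longleftrightarrow>
    product_rule F l i" (is "?L \<longleftrightarrow> _") if i: "i < d" for i
  proof -
    obtain u m v where lu: "l = u @ m # v" "length u = i"
      using i unfolding d_def by (rule list_split_at)
    have m: "0 < m" "l ! i = m" using l0 lu by (auto simp: nth_append)
    have comp: "(\<Sum>p\<in>opart_nd 2 m. mrg d i (F (opart_comp p i l) t)) =
        (\<Sum>p\<in>opart_nd 2 m. mrg d i (P (opart_comp p i l) t))" for t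
      by (rule sum.cong) (use FP opart_comp_nondeg[OF l n] i m d_def in auto)
    have expand: "(\<Sum>k\<in>splits i l. mrg d i (F k (tens scale (us @ a # b # vs)))) =
        lmul_at scale d i a (P l (tens scale (us @ b # vs))) +
        rmul_at scale d i b (P l (tens scale (us @ a # vs))) +
        (\<Sum>p \<in> opart_nd 2 m. mrg d i (P (opart_comp p i l) (tens scale (us @ a # b # vs))))"
      if "length us = i" "Suc (i + length vs) = d" for us a b vs
    proof -
      have "length vs = length v" using that lu d_def by simp
      from product_expansion[OF F lu suml m(1) that(1) this d_def] show ?thesis
        unfolding FP[OF l] comp .
    qed
    have "?L \<longleftrightarrow> (\<forall>us a b vs. length us = i \<longrightarrow> Suc (i + length vs) = d \<longrightarrow>
      P l (tens scale (us @ a * b # vs)) =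
        lmul_at scale d i a (P l (tens scale (us @ b # vs))) +
        rmul_at scale d i b (P l (tens scale (us @ a # vs))) +
        (\<Sum>p \<in> opart_nd 2 m. mrg d i (P (opart_comp p i l) (tens scale (us @ a # b # vs)))))"
      (is "_ \<longleftrightarrow> ?M")
    proof
      assume L: ?L
      show ?M
      proof (intro allI impI)
        fix us vs :: "'a list" and a b
        assume len: "length us = i" "Suc (i + length vs) = d"
        show "P l (tens scale (us @ a * b # vs)) =
          lmul_at scale d i a (P l (tens scale (us @ b # vs))) +
          rmul_at scale d i b (P l (tens scale (us @ a # vs))) +
          (\<Sum>p \<in> opart_nd 2 m. mrg d i (P (opart_comp p i l) (tens scale (us @ a # b # vs))))"
          using L[rule_format, of "us @ a # vs" a b] len m d_def by (simp only: list_update_append) simp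
      qed
    next
      assume M: ?M
      show ?L
      proof (intro allI impI)
        fix xs :: "'a list" and a b
        assume len: "length xs = d"
        then have "i < length xs" using i by simp
        then obtain us x vs where "xs = us @ x # vs" "length us = i"
          by (rule list_split_at)
        then show "P l (tens scale (xs[i := a * b])) =
          lmul_at scale d i a (P l (tens scale (xs[i := b]))) +
          rmul_at scale d i b (P l (tens scale (xs[i := a]))) +
          (\<Sum>p \<in> opart_nd 2 (l ! i). mrg d i
             (P (opart_comp p i l) (tens scale (take i xs @ a # b # drop (Suc i) xs))))"
          using M[rule_format, of us vs a b] len m d_def by (simp only: list_update_append) simp
      qed
    qed
    also have "\<dots> \<longleftrightarrow> product_rule F l i"
      unfolding product_rule_iff[OF F(1) suml i[unfolded d_def]] d_def[symmetric] FP[OF l]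
      by (intro all_cong1 imp_cong refl, subst expand) (rule refl | assumption)+
    finally show ?thesis .
  qed
  then show ?thesis unfolding leibniz_def Let_def d_def by blast
qed

text \<open>
  Evaluate both sides on a tensor with a factor inserted at the place of the new \<open>0\<close>, which \<open>F\<close>
  leaves alone.  If the multiplication does not involve this factor, insertion can be moved past
  it, and the rule at \<open>u @ v\<close> applies.  If it does, the part in question is \<open>0\<close>, it splits only as
  \<open>0 + 0\<close>, and both sides multiply two factors on which nothing acts.
\<close>

lemma product_rule_insert_zero:
  assumes F: "endo n F" "zeros_act_trivially n F"
    and l: "u @ v \<noteq> []" "sum_list (u @ v) = n"
    and IH: "\<And>i. i < length (u @ v) \<Longrightarrow> product_rule F (u @ v) i"
    and i: "i < length (u @ 0 # v)"
  shows "product_rule F (u @ 0 # v) i"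
proof -
  define d where "d = length (u @ v)"
  define j where "j = length u"
  have jd: "j \<le> d" by (simp add: j_def d_def)
  have Fl: "F (u @ v) \<in> hom d d" using F(1) l d_def by (intro endoD) auto
  have F0: "F (u @ 0 # v) = iid d j (F (u @ v))"
    using zerosD[OF F(2) l] by (simp add: d_def j_def)
  have F0_hom: "F (u @ 0 # v) \<in> hom (Suc d) (Suc d)"
    unfolding F0 by (rule iid_hom[OF jd Fl])
  have k_hom: "F k \<in> hom (Suc (Suc d)) (Suc (Suc d))" if "k \<in> splits i (u @ 0 # v)" for k
    using splits_endo[OF F(1) _ i that] l by (simp add: d_def)
  have id: "i < Suc d" using i by (simp add: d_def)
  have lhs: "F (u @ 0 # v) \<circ> mrg (Suc d) i \<in> hom (Suc (Suc d)) (Suc d)"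
    by (rule hom_o[OF F0_hom mrg_hom[OF id]])
  have rhs: "(\<Sum>k\<in>splits i (u @ 0 # v). mrg (Suc d) i \<circ> F k) \<in> hom (Suc (Suc d)) (Suc d)"
    by (rule hom_sum, rule hom_o[OF mrg_hom[OF id] k_hom])
  have IH': "F (u @ v) (mrg d i' t) = (\<Sum>k\<in>splits i' (u @ v). mrg d i' (F k t))" if "i' < d" for i' t
    using IH[of i'] that unfolding product_rule_def d_def[symmetric]
    by (metis (mono_tags, lifting) o_apply sum_fun_apply sum.cong)
  have sub_hom: "F k \<in> hom (Suc d) (Suc d)" if "k \<in> splits i' (u @ v)" "i' < d" for k i'
    using splits_endo[OF F(1) l(2)] that by (simp add: d_def)
  consider "i = j" | i' where "j \<le> i'" "i = Suc i'" | "i < j"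
    by (cases i; cases "i < j"; cases "i = j") auto
  then have "F (u @ 0 # v) \<circ> mrg (Suc d) i = (\<Sum>k\<in>splits i (u @ 0 # v). mrg (Suc d) i \<circ> F k)"
  proof cases
    case 1
    \<comment> \<open>Inserting a second factor exhibits both of the factors that are multiplied.\<close>
    have *: "(\<Sum>k\<in>splits i (u @ 0 # v). g k) = g (u @ 0 # 0 # v)" for g :: "nat list \<Rightarrow> ('k,'a) tensor \<Rightarrow> ('k,'a) tensor"
      using sum_splits[of u i g 0 v] 1 by (simp add: j_def)
    have F00: "F (u @ 0 # 0 # v) = iid (Suc d) j (F (u @ 0 # v))"
      using zerosD[OF F(2), of u "0 # v"] l by (simp add: d_def j_def)
    show ?thesis
    proof (rule hom_eqI_ins[OF lhs rhs])
      show "j \<le> Suc d" using jd by simp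
      fix a t assume t: "t \<in> pw (Suc d)"
      have "F (u @ 0 # v) \<circ> (mrg (Suc d) j \<circ> ins (Suc d) j a) = mrg (Suc d) j \<circ> F (u @ 0 # 0 # v) \<circ> ins (Suc d) j a"
      proof (rule hom_eqI_ins[OF _ _ jd])
        show "F (u @ 0 # v) \<circ> (mrg (Suc d) j \<circ> ins (Suc d) j a) \<in> hom (Suc d) (Suc d)"
          using jd by (intro hom_o[OF F0_hom hom_o[OF mrg_hom ins_hom]]) auto
        show "mrg (Suc d) j \<circ> F (u @ 0 # 0 # v) \<circ> ins (Suc d) j a \<in> hom (Suc d) (Suc d)"
          unfolding F00 using jd by (intro hom_o[OF hom_o[OF mrg_hom iid_hom] ins_hom] F0_hom) auto
        fix b s assume s: "s \<in> pw d"
        have Fs: "F (u @ v) s \<in> pw d" by (rule hom_pw[OF Fl s])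
        have ins_pw: "ins d j b s \<in> pw (Suc d)" by (rule hom_pw[OF ins_hom[OF jd] s])
        have "F (u @ 0 # v) (mrg (Suc d) j (ins (Suc d) j a (ins d j b s))) = ins d j (a * b) (F (u @ v) s)"
          unfolding mrg_ins_ins[OF jd s] F0 by (rule iid_ins[OF jd Fl s])
        also have "\<dots> = mrg (Suc d) j (ins (Suc d) j a (ins d j b (F (u @ v) s)))"
          by (rule mrg_ins_ins[OF jd Fs, symmetric])
        also have "ins d j b (F (u @ v) s) = F (u @ 0 # v) (ins d j b s)"
          unfolding F0 by (rule iid_ins[OF jd Fl s, symmetric])
        also have "ins (Suc d) j a (F (u @ 0 # v) (ins d j b s)) = F (u @ 0 # 0 # v) (ins (Suc d) j a (ins d j b s))"
          unfolding F00 by (rule iid_ins[OF _ F0_hom ins_pw, symmetric]) (use jd in simp)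
        finally show "(F (u @ 0 # v) \<circ> (mrg (Suc d) j \<circ> ins (Suc d) j a)) (ins d j b s) =
            (mrg (Suc d) j \<circ> F (u @ 0 # 0 # v) \<circ> ins (Suc d) j a) (ins d j b s)"
          by (simp only: o_apply)
      qed
      from fun_cong[OF this, of t]
      show "(F (u @ 0 # v) \<circ> mrg (Suc d) i) (ins (Suc d) j a t) =
          (\<Sum>k\<in>splits i (u @ 0 # v). mrg (Suc d) i \<circ> F k) (ins (Suc d) j a t)"
        unfolding *[unfolded 1] 1 by (simp only: o_apply)
    qed
  next
    case (2 i')
    have i': "i' < d" using id 2 by simp
    have "i' - j < length v" using 2 i' by (simp add: d_def j_def)
    then obtain v1 m v2 where v: "v = v1 @ m # v2" "length v1 = i' - j"
      by (rule list_split_at)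
    have reindex: "(\<Sum>k\<in>splits i (u @ 0 # v). g k) = (\<Sum>k\<in>splits i' (u @ v). g (take j k @ 0 # drop j k))"
      for g :: "nat list \<Rightarrow> ('k,'a) tensor"
      using sum_splits[of "u @ 0 # v1" i g m v2] sum_splits[of "u @ v1" i' "\<lambda>k. g (take j k @ 0 # drop j k)" m v2] 2 v
      by (simp add: j_def)
    show ?thesis
    proof (rule hom_eqI_ins[OF lhs rhs])
      show "j \<le> Suc d" using jd by simp
      fix a t assume t: "t \<in> pw (Suc d)"
      have mt: "mrg d i' t \<in> pw d" by (rule hom_pw[OF mrg_hom[OF i'] t])
      have Fkt: "F k t \<in> pw (Suc d)" if "k \<in> splits i' (u @ v)" for k
        by (rule hom_pw[OF sub_hom[OF that i'] t])
      have "F (u @ 0 # v) (mrg (Suc d) i (ins (Suc d) j a t)) = ins d j a (F (u @ v) (mrg d i' t))"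
        unfolding 2(2) mrg_ins_before[OF 2(1) i' t] F0 by (rule iid_ins[OF jd Fl mt])
      also have "\<dots> = (\<Sum>k\<in>splits i' (u @ v). ins d j a (mrg d i' (F k t)))"
        unfolding IH'[OF i'] by (rule hom_sum_apply[OF ins_hom[OF jd] hom_pw[OF mrg_hom[OF i'] Fkt]])
      also have "\<dots> = (\<Sum>k\<in>splits i' (u @ v). mrg (Suc d) i (F (take j k @ 0 # drop j k) (ins (Suc d) j a t)))"
      proof (rule sum.cong[OF refl])
        fix k assume k: "k \<in> splits i' (u @ v)"
        have "length k = Suc d" "sum_list k = n" "k \<noteq> []"
          using k sum_list_merge[of i' k] i' l by (auto simp: splits_def d_def)
        then have "F (take j k @ 0 # drop j k) = iid (Suc d) j (F k)"
          using zerosD[OF F(2), of "take j k" "drop j k" "Suc d" j] jd by force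
        then have "F (take j k @ 0 # drop j k) (ins (Suc d) j a t) = ins (Suc d) j a (F k t)"
          using iid_ins[OF _ sub_hom[OF k i'] t] jd by simp
        then show "ins d j a (mrg d i' (F k t)) = mrg (Suc d) i (F (take j k @ 0 # drop j k) (ins (Suc d) j a t))"
          using mrg_ins_before[OF 2(1) i' Fkt[OF k]] 2(2) by simp
      qed
      also have "\<dots> = (\<Sum>k\<in>splits i (u @ 0 # v). mrg (Suc d) i (F k (ins (Suc d) j a t)))"
        by (rule reindex[symmetric])
      finally show "(F (u @ 0 # v) \<circ> mrg (Suc d) i) (ins (Suc d) j a t) =
          (\<Sum>k\<in>splits i (u @ 0 # v). mrg (Suc d) i \<circ> F k) (ins (Suc d) j a t)"
        by (simp only: sum_fun_apply o_apply)
    qed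
  next
    case 3
    have i': "i < d" using 3 jd by simp
    have "i < length u" using 3 by (simp add: j_def)
    then obtain u1 m u2 where u: "u = u1 @ m # u2" "length u1 = i"
      by (rule list_split_at)
    \<comment> \<open>Splitting a part to the left of the \<open>0\<close> moves the \<open>0\<close> from position \<open>j\<close> to \<open>Suc j\<close>.\<close>
    have reindex: "(\<Sum>k\<in>splits i (u @ 0 # v). g k) = (\<Sum>k\<in>splits i (u @ v). g (take (Suc j) k @ 0 # drop (Suc j) k))"
      for g :: "nat list \<Rightarrow> ('k,'a) tensor"
      using sum_splits[of u1 i g m "u2 @ 0 # v"] sum_splits[of u1 i "\<lambda>k. g (take (Suc j) k @ 0 # drop (Suc j) k)" m "u2 @ v"] u
      by (simp add: j_def)
    show ?thesis
    proof (rule hom_eqI_ins[OF lhs rhs])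
      show "Suc j \<le> Suc d" using jd by simp
      fix a t assume t: "t \<in> pw (Suc d)"
      have mt: "mrg d i t \<in> pw d" by (rule hom_pw[OF mrg_hom[OF i'] t])
      have Fkt: "F k t \<in> pw (Suc d)" if "k \<in> splits i (u @ v)" for k
        by (rule hom_pw[OF sub_hom[OF that i'] t])
      have "F (u @ 0 # v) (mrg (Suc d) i (ins (Suc d) (Suc j) a t)) = ins d j a (F (u @ v) (mrg d i t))"
        unfolding mrg_ins_after[OF 3 jd t] F0 by (rule iid_ins[OF jd Fl mt])
      also have "\<dots> = (\<Sum>k\<in>splits i (u @ v). ins d j a (mrg d i (F k t)))"
        unfolding IH'[OF i'] by (rule hom_sum_apply[OF ins_hom[OF jd] hom_pw[OF mrg_hom[OF i'] Fkt]])
      also have "\<dots> = (\<Sum>k\<in>splits i (u @ v). mrg (Suc d) i (F (take (Suc j) k @ 0 # drop (Suc j) k) (ins (Suc d) (Suc j) a t)))"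
      proof (rule sum.cong[OF refl])
        fix k assume k: "k \<in> splits i (u @ v)"
        have "length k = Suc d" "sum_list k = n" "k \<noteq> []"
          using k sum_list_merge[of i k] i' l by (auto simp: splits_def d_def)
        then have "F (take (Suc j) k @ 0 # drop (Suc j) k) = iid (Suc d) (Suc j) (F k)"
          using zerosD[OF F(2), of "take (Suc j) k" "drop (Suc j) k" "Suc d" "Suc j"] jd by force
        then have "F (take (Suc j) k @ 0 # drop (Suc j) k) (ins (Suc d) (Suc j) a t) = ins (Suc d) (Suc j) a (F k t)"
          using iid_ins[OF _ sub_hom[OF k i'] t] jd by simp
        then show "ins d j a (mrg d i (F k t)) = mrg (Suc d) i (F (take (Suc j) k @ 0 # drop (Suc j) k) (ins (Suc d) (Suc j) a t))"
          using mrg_ins_after[OF 3 jd Fkt[OF k]] by simp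
      qed
      also have "\<dots> = (\<Sum>k\<in>splits i (u @ 0 # v). mrg (Suc d) i (F k (ins (Suc d) (Suc j) a t)))"
        by (rule reindex[symmetric])
      finally show "(F (u @ 0 # v) \<circ> mrg (Suc d) i) (ins (Suc d) (Suc j) a t) =
          (\<Sum>k\<in>splits i (u @ 0 # v). mrg (Suc d) i \<circ> F k) (ins (Suc d) (Suc j) a t)"
        by (simp only: sum_fun_apply o_apply)
    qed
  qed
  then show ?thesis by (simp add: product_rule_def d_def)
qed

lemma degenerate_zero:
  assumes "degenerate l"
  obtains u v where "l = u @ 0 # v" "u @ v \<noteq> []" "length u = length (takeWhile (\<lambda>x. x \<noteq> 0) l)"
proof -
  let ?i = "length (takeWhile (\<lambda>x. x \<noteq> 0) l)"
  have "0 \<in> set l" using assms by (cases l) (auto simp: degenerate_def)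
  then have i: "?i < length l" by (rule length_takeWhile_nonzero)
  then obtain u x v where l: "l = u @ x # v" "length u = ?i"
    by (rule list_split_at)
  have "l ! ?i = 0" using i nth_length_takeWhile by fastforce
  then have "x = 0" using l by (metis nth_append_length)
  with l assms show thesis by (intro that[of u v]) (auto simp: degenerate_def)
qed

text \<open>
  The product rule at a degenerate partition follows from the one at a shorter partition, by removing
  a zero.  The remaining cases are the Leibniz rule itself and, in order \<open>0\<close>, the partition \<open>[0]\<close>,
  where the operator is a multiple of the identity.
\<close>

lemma extend_total:
  assumes P: "P \<in> diffop scale n"
  shows "total_diffop n (extend scale P)"
proof -
  let ?F = "extend scale P"
  have F: "endo n ?F"
    unfolding endo_def using extend_thom[OF vs P] by (auto simp: opart_def Suc_le_eq)
  have Z: "zeros_act_trivially n ?F"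
    unfolding zeros_act_trivially_def
  proof (intro allI impI)
    fix u v :: "nat list" assume "u @ v \<noteq> []" "sum_list (u @ v) = n"
    then show "?F (u @ 0 # v) = iid (length (u @ v)) (length u) (?F (u @ v))"
      using extend_insert[OF vs P, of "length (u @ v)" "u @ v" "length u"]
      by (auto simp: opart_def Suc_le_eq)
  qed
  have nd: "?F l = P l" if "nondeg n l" for l
    using that by (subst extend.simps) (simp add: nondeg_def)
  have c: "\<exists>c. ?F [0] = (\<lambda>t. tscale c (tid scale 1 t))" if "n = 0"
    using P that nd[of "[0]"] by (auto simp: diffop_def nondeg_def degenerate_def)
  have "product_rule ?F l i" if "sum_list l = n" "i < length l" for l i
    using that
  proof (induction "length l" arbitrary: l i rule: less_induct)
    case less
    show ?case
    proof (cases "degenerate l")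
      case True
      then obtain u v where l: "l = u @ 0 # v" "u @ v \<noteq> []"
        by (rule degenerate_zero)
      show ?thesis
        unfolding l(1) by (rule product_rule_insert_zero[OF F Z l(2)])
          (use less l in auto)
    next
      case False
      then have ndl: "nondeg n l" using less.prems by (auto simp: nondeg_def)
      show ?thesis
      proof (cases "n = 0")
        case True
        then obtain c where c: "?F [0] = (\<lambda>t. tscale c (tid scale 1 t))" using c by blast
        have l: "l = [0]" "i = 0"
          using ndl True less.prems by (cases l; auto simp: nondeg_def degenerate_def)+
        have "?F [0, 0] = iid 1 0 (\<lambda>t. tscale c (tid scale 1 t))"
          using zerosD[OF Z, of "[]" "[0]" 1 0] True c by simp
        also have "\<dots> = (\<lambda>t. tscale c (tid scale 2 t))"
          using iid_tscale[of 0 1 "tid scale 1" c] iid_tid[of 0 1] tid_hom by (simp add: numeral_2_eq_2)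
        finally have F00: "?F [0, 0] = (\<lambda>t. tscale c (tid scale 2 t))" .
        have "?F [0] \<circ> mrg 1 0 = (\<lambda>t. tscale c ((tid scale 1 \<circ> mrg 1 0) t))"
          by (simp only: c o_def)
        also have "tid scale 1 \<circ> mrg 1 0 = mrg 1 0" by (rule tid_o[OF mrg_hom]) simp
        finally have lhs: "?F [0] \<circ> mrg 1 0 = (\<lambda>t. tscale c (mrg 1 0 t))" .
        have "mrg 1 0 \<circ> ?F [0, 0] = (\<lambda>t. tscale c ((mrg 1 0 \<circ> tid scale 2) t))"
          unfolding F00 using o_tscale_hom[OF mrg_hom[of 0 1] tid_hom] by (simp add: numeral_2_eq_2)
        also have "mrg 1 0 \<circ> tid scale 2 = mrg 1 0"
          using o_tid[OF mrg_hom[of 0 1]] by (simp add: numeral_2_eq_2)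
        finally have eq: "?F [0] \<circ> mrg 1 0 = mrg 1 0 \<circ> ?F [0, 0]" using lhs by (simp only:)
        have "(\<Sum>k\<in>splits 0 [0]. mrg 1 0 \<circ> ?F k) = mrg 1 0 \<circ> ?F [0, 0]"
          using sum_splits[of "[]" 0 "\<lambda>k. mrg 1 0 \<circ> ?F k" 0 "[]"] by simp
        moreover have "length [0 :: nat] = 1" by simp
        ultimately show ?thesis
          unfolding product_rule_def l using eq by (simp only:)
      next
        case False
        then have "l \<in> opart_nd (length l) n" "1 \<le> length l"
          using ndl by (auto simp: nondeg_def opart_nd_def opart_def Suc_le_eq)
        then have "leibniz scale P l" using P False by (auto simp: diffop_def)
        then show ?thesis
          using leibniz_iff[OF F Z nd ndl] False less.prems(2) by simp
      qed
    qed
  qed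
  with F Z c show ?thesis by (auto simp: total_diffop_def)
qed

definition nondeg_part :: "nat \<Rightarrow> ('k, 'a) family \<Rightarrow> ('k, 'a) family"
  where "nondeg_part n F l = (if nondeg n l then F l else 0)"

text \<open>
  Removing zeros from a degenerate partition one at a time ends at a nondegenerate one.
\<close>

lemma extend_nondeg_part:
  assumes F: "zeros_act_trivially n F" and l: "l \<noteq> []" "sum_list l = n"
  shows "extend scale (nondeg_part n F) l = F l"
  using l
proof (induction "length l" arbitrary: l rule: less_induct)
  case less
  show ?case
  proof (cases "degenerate l")
    case True
    then obtain u v where l: "l = u @ 0 # v" "u @ v \<noteq> []" "length u = length (takeWhile (\<lambda>x. x \<noteq> 0) l)"
      by (rule degenerate_zero)
    have "extend scale (nondeg_part n F) l =
        iid (length (u @ v)) (length u) (extend scale (nondeg_part n F) (u @ v))"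
      using extend_degenerate[OF True l(3), of "length (u @ v)"] l(1) by simp
    also have "extend scale (nondeg_part n F) (u @ v) = F (u @ v)"
      using less l by auto
    also have "iid (length (u @ v)) (length u) (F (u @ v)) = F l"
      using zerosD[OF F l(2)] less.prems(2) l(1) by simp
    finally show ?thesis .
  next
    case False
    then show ?thesis
      using less.prems by (subst extend.simps) (simp add: nondeg_part_def nondeg_def)
  qed
qed

lemma nondeg_part_diffop:
  assumes "total_diffop n F"
  shows "nondeg_part n F \<in> diffop scale n"
proof -
  have F: "endo n F" and Z: "zeros_act_trivially n F"
    and pr: "\<And>l i. sum_list l = n \<Longrightarrow> i < length l \<Longrightarrow> product_rule F l i"
    and c: "n = 0 \<Longrightarrow> \<exists>c. F [0] = (\<lambda>t. tscale c (tid scale 1 t))"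
    using assms by (auto simp: total_diffop_def)
  have nd: "nondeg n l" if "1 \<le> d" "l \<in> opart_nd d n" for d l
    using that by (auto simp: nondeg_def opart_nd_def opart_def)
  have "nondeg_part n F l \<in> hom d d" if "1 \<le> d" "l \<in> opart_nd d n" for d l
    using nd[OF that] F that(2)
    by (auto simp: nondeg_part_def nondeg_def opart_nd_def opart_def endo_def)
  moreover have "nondeg_part n F l = 0" if "l \<notin> (\<Union>d\<in>{1..}. opart_nd d n)" for l
    using that unfolding nondeg_iff by (simp add: nondeg_part_def)
  moreover have "\<exists>c. nondeg_part n F [0] = (\<lambda>t. tscale c (tid scale 1 t))" if "n = 0"
    using c that by (simp add: nondeg_part_def nondeg_def degenerate_def)
  moreover have "leibniz scale (nondeg_part n F) l" if "0 < n" "1 \<le> d" "l \<in> opart_nd d n" for d l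
    using leibniz_iff[OF F Z, of "nondeg_part n F" l] nd[OF that(2,3)] that(1) pr
    by (simp add: nondeg_part_def nondeg_def)
  ultimately show ?thesis unfolding diffop_def by auto
qed

lemma nondeg_part_extend:
  assumes "P \<in> diffop scale n"
  shows "nondeg_part n (extend scale P) = P"
proof
  fix l
  show "nondeg_part n (extend scale P) l = P l"
  proof (cases "nondeg n l")
    case True
    then show ?thesis by (subst nondeg_part_def, subst extend.simps) (simp add: nondeg_def)
  next
    case False
    then have "P l = 0" using assms unfolding diffop_def nondeg_iff by blast
    with False show ?thesis by (simp add: nondeg_part_def)
  qed
qed

end


section \<open>Composition\<close>

lemma length_merge: "Suc i < length x \<Longrightarrow> length (merge_list f i x) = length x - 1"
  by (erule list_split_at2) (simp add: merge_list_append)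

lemma merge_list_map2:
  assumes "Suc i < length x" "length x = length y"
  shows "merge_list (+) i (map2 (+) x y) = map2 (+) (merge_list (+) i x) (merge_list (+) i (y :: nat list))"
  using assms
  by (simp add: merge_list_def take_map drop_map take_zip drop_zip algebra_simps)

lemma sum_list_map2:
  "length x = length y \<Longrightarrow> sum_list (map2 (+) x y) = sum_list x + sum_list (y :: nat list)"
  by (induction x y rule: list_induct2) auto

lemma map2_plus_assoc:
  "map2 (+) (map2 (+) x y) z = map2 (+) x (map2 (+) y (z :: nat list))"
  by (auto simp: list_eq_iff_nth_eq)

definition decomp :: "nat \<Rightarrow> nat \<Rightarrow> nat list \<Rightarrow> (nat list \<times> nat list) set"
  where "decomp m n l =
    {(x, y). x \<in> opart (length l) m \<and> y \<in> opart (length l) n \<and> map2 (+) x y = l}"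

lemma decomp_iff:
  "(x, y) \<in> decomp m n l \<longleftrightarrow> length x = length l \<and> length y = length l \<and>
    sum_list x = m \<and> sum_list y = n \<and> map2 (+) x y = l"
  by (auto simp: decomp_def opart_def)

lemma decompI:
  "length x = length y \<Longrightarrow> sum_list x = m \<Longrightarrow> sum_list y = n \<Longrightarrow> (x, y) \<in> decomp m n (map2 (+) x y)"
  by (simp add: decomp_iff)

lemma finite_decomp: "finite (decomp m n l)"
proof (rule finite_subset)
  have "finite (opart (length l) n)" for n
    by (rule finite_subset[OF _ finite_lists_length_eq[of "{..n}" "length l"]])
      (auto simp: opart_def member_le_sum_list)
  then show "finite (opart (length l) m \<times> opart (length l) n)" by blast
qed (auto simp: decomp_def)

text \<open>
  A sum of natural numbers is \<open>0\<close> only if both summands are, so both components of a decomposition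
  have a \<open>0\<close> wherever their sum does.
\<close>

lemma decomp_insert_zero:
  "bij_betw (\<lambda>(x, y). (take (length u) x @ 0 # drop (length u) x, take (length u) y @ 0 # drop (length u) y))
    (decomp m n (u @ v)) (decomp m n (u @ 0 # v))"
proof (rule bij_betw_byWitness[where f' = "\<lambda>(x, y). (take (length u) x @ drop (Suc (length u)) x,
      take (length u) y @ drop (Suc (length u)) y)"])
  let ?i = "length u"
  have ins: "sum_list (take ?i x @ 0 # drop ?i x) = sum_list x" for x :: "nat list"
    by (metis add_0 append_take_drop_id sum_list.Cons sum_list.append)
  have split: "\<exists>x1 x2 y1 y2. x = x1 @ 0 # x2 \<and> y = y1 @ 0 # y2 \<and> length x1 = ?i \<and> length y1 = ?i \<and>
      length x2 = length v \<and> length y2 = length v \<and> map2 (+) x1 y1 = u \<and> map2 (+) x2 y2 = v"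
    if xy: "(x, y) \<in> decomp m n (u @ 0 # v)" for x y
  proof -
    have len: "?i < length x" "?i < length y" using xy by (auto simp: decomp_iff)
    obtain x1 a x2 where x: "x = x1 @ a # x2" "length x1 = ?i" using len(1) by (rule list_split_at)
    obtain y1 b y2 where y: "y = y1 @ b # y2" "length y1 = ?i" using len(2) by (rule list_split_at)
    show ?thesis using xy x y by (auto simp: decomp_iff)
  qed
  show "\<forall>p\<in>decomp m n (u @ v). (case case p of (x, y) \<Rightarrow> (take ?i x @ 0 # drop ?i x, take ?i y @ 0 # drop ?i y) of
      (x, y) \<Rightarrow> (take ?i x @ drop (Suc ?i) x, take ?i y @ drop (Suc ?i) y)) = p"
    by (auto simp: decomp_iff)
  show "\<forall>p\<in>decomp m n (u @ 0 # v). (case case p of (x, y) \<Rightarrow> (take ?i x @ drop (Suc ?i) x, take ?i y @ drop (Suc ?i) y) of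
      (x, y) \<Rightarrow> (take ?i x @ 0 # drop ?i x, take ?i y @ 0 # drop ?i y)) = p"
  proof
    fix p assume p: "p \<in> decomp m n (u @ 0 # v)"
    obtain x y where xy: "p = (x, y)" by (cases p)
    show "(case case p of (x, y) \<Rightarrow> (take ?i x @ drop (Suc ?i) x, take ?i y @ drop (Suc ?i) y) of
      (x, y) \<Rightarrow> (take ?i x @ 0 # drop ?i x, take ?i y @ 0 # drop ?i y)) = p"
    proof -
      obtain x1 x2 y1 y2 where "x = x1 @ 0 # x2" "y = y1 @ 0 # y2" "length x1 = ?i" "length y1 = ?i"
        using split[OF p[unfolded xy]] by blast
      then show ?thesis by (simp add: xy)
    qed
  qed
  show "(\<lambda>(x, y). (take ?i x @ 0 # drop ?i x, take ?i y @ 0 # drop ?i y)) ` decomp m n (u @ v)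
      \<subseteq> decomp m n (u @ 0 # v)"
  proof clarify
    fix x y assume xy: "(x, y) \<in> decomp m n (u @ v)"
    have "map2 (+) (take ?i x) (take ?i y) = u" "map2 (+) (drop ?i x) (drop ?i y) = v"
      using xy by (auto simp: decomp_iff simp flip: take_map drop_map take_zip drop_zip)
    then show "(take ?i x @ 0 # drop ?i x, take ?i y @ 0 # drop ?i y) \<in> decomp m n (u @ 0 # v)"
      using xy unfolding decomp_iff ins by (auto simp: decomp_iff)
  qed
  show "(\<lambda>(x, y). (take ?i x @ drop (Suc ?i) x, take ?i y @ drop (Suc ?i) y)) ` decomp m n (u @ 0 # v)
      \<subseteq> decomp m n (u @ v)"
  proof clarify
    fix x y assume xy: "(x, y) \<in> decomp m n (u @ 0 # v)"
    from split[OF this] obtain x1 x2 y1 y2 where "x = x1 @ 0 # x2" "y = y1 @ 0 # y2"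
      "length x1 = ?i" "length y1 = ?i" "length x2 = length v" "length y2 = length v"
      "map2 (+) x1 y1 = u" "map2 (+) x2 y2 = v"
      by blast
    with xy show "(take ?i x @ drop (Suc ?i) x, take ?i y @ drop (Suc ?i) y) \<in> decomp m n (u @ v)"
      by (simp add: decomp_iff)
  qed
qed

text \<open>
  The heart of the closure under composition.  Merging commutes with termwise addition, so both
  sums range over all pairs \<open>(x', y')\<close> of partitions of \<open>m\<close> and \<open>n\<close> whose termwise sum merges to
  \<open>l\<close>: on the left the pair is
  merged first and added afterwards, on the right it is added first.
\<close>

lemma sum_decomp_splits:
  fixes g :: "nat list \<Rightarrow> nat list \<Rightarrow> 'b::comm_monoid_add"
  assumes "i < length l"
  shows "(\<Sum>(x, y)\<in>decomp m n l. \<Sum>x'\<in>splits i x. \<Sum>y'\<in>splits i y. g x' y') =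
    (\<Sum>k\<in>splits i l. \<Sum>(x', y')\<in>decomp m n k. g x' y')"
proof -
  have "(\<Sum>(x, y)\<in>decomp m n l. \<Sum>x'\<in>splits i x. \<Sum>y'\<in>splits i y. g x' y') =
      (\<Sum>(p, (x', y'))\<in>(SIGMA p:decomp m n l. splits i (fst p) \<times> splits i (snd p)). g x' y')"
    using assms
    by (subst sum.Sigma[symmetric])
      (auto simp: finite_decomp decomp_iff sum.cartesian_product case_prod_unfold intro!: finite_cartesian_product splits_finite)
  also have "\<dots> = (\<Sum>(k, (x', y'))\<in>(SIGMA k:splits i l. decomp m n k). g x' y')"
  proof (rule sum.reindex_bij_witness[where i = "\<lambda>(k, (x', y')). ((merge_list (+) i x', merge_list (+) i y'), (x', y'))"
        and j = "\<lambda>(p, (x', y')). (map2 (+) x' y', (x', y'))"])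
    fix q assume "q \<in> (SIGMA p:decomp m n l. splits i (fst p) \<times> splits i (snd p))"
    then obtain x y x' y' where q: "q = ((x, y), (x', y'))" "(x, y) \<in> decomp m n l"
      "x' \<in> splits i x" "y' \<in> splits i y" by auto
    have *: "length x' = Suc (length l)" "length y' = Suc (length l)"
      "merge_list (+) i x' = x" "merge_list (+) i y' = y"
      using q by (auto simp: splits_def decomp_iff)
    then have sums: "sum_list x' = m" "sum_list y' = n"
      using sum_list_merge[of i x'] sum_list_merge[of i y'] assms q(2) by (auto simp: decomp_iff)
    have "merge_list (+) i (map2 (+) x' y') = l"
      using merge_list_map2[of i x' y'] * q(2) assms by (simp add: decomp_iff)
    then show "(case q of (p, (x', y')) \<Rightarrow> (map2 (+) x' y', (x', y'))) \<in> (SIGMA k:splits i l. decomp m n k)"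
      using * sums by (simp add: q(1) splits_def decompI)
    show "(case (case q of (p, (x', y')) \<Rightarrow> (map2 (+) x' y', (x', y'))) of
        (k, (x', y')) \<Rightarrow> ((merge_list (+) i x', merge_list (+) i y'), (x', y'))) = q"
      using * by (simp add: q(1))
    show "(case (case q of (p, (x', y')) \<Rightarrow> (map2 (+) x' y', (x', y'))) of (k, (x', y')) \<Rightarrow> g x' y') =
        (case q of (p, (x', y')) \<Rightarrow> g x' y')"
      by (simp add: q(1))
  next
    fix q assume "q \<in> (SIGMA k:splits i l. decomp m n k)"
    then obtain k x' y' where q: "q = (k, (x', y'))" "k \<in> splits i l" "(x', y') \<in> decomp m n k" by auto
    have *: "length k = Suc (length l)" "merge_list (+) i k = l" "length x' = length k" "length y' = length k"
      "map2 (+) x' y' = k" "sum_list x' = m" "sum_list y' = n"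
      using q by (auto simp: splits_def decomp_iff)
    have "map2 (+) (merge_list (+) i x') (merge_list (+) i y') = l"
      using merge_list_map2[of i x' y'] * assms by simp
    then have "(merge_list (+) i x', merge_list (+) i y') \<in> decomp m n l"
      using * assms by (simp add: decomp_iff length_merge sum_list_merge)
    then show "(case q of (k, (x', y')) \<Rightarrow> ((merge_list (+) i x', merge_list (+) i y'), (x', y')))
        \<in> (SIGMA p:decomp m n l. splits i (fst p) \<times> splits i (snd p))"
      using * assms by (simp add: q(1) splits_def length_merge)
    show "(case (case q of (k, (x', y')) \<Rightarrow> ((merge_list (+) i x', merge_list (+) i y'), (x', y'))) of
        (p, (x', y')) \<Rightarrow> (map2 (+) x' y', (x', y'))) = q"
      using * by (simp add: q(1))
  qed
  also have "\<dots> = (\<Sum>k\<in>splits i l. \<Sum>(x', y')\<in>decomp m n k. g x' y')"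
    using assms by (subst sum.Sigma[symmetric]) (auto simp: finite_decomp splits_finite)
  finally show ?thesis .
qed

text \<open>Both sides sum over the triples with termwise sum \<open>l\<close>.\<close>

lemma sum_decomp_assoc:
  fixes g :: "nat list \<Rightarrow> nat list \<Rightarrow> nat list \<Rightarrow> 'b::comm_monoid_add"
  shows "(\<Sum>(w, z)\<in>decomp (a + b) c l. \<Sum>(x, y)\<in>decomp a b w. g x y z) =
    (\<Sum>(x, w)\<in>decomp a (b + c) l. \<Sum>(y, z)\<in>decomp b c w. g x y z)"
proof -
  have "(\<Sum>(w, z)\<in>decomp (a + b) c l. \<Sum>(x, y)\<in>decomp a b w. g x y z) =
      (\<Sum>((w, z), (x, y))\<in>(SIGMA p:decomp (a + b) c l. decomp a b (fst p)). g x y z)"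
    by (subst sum.Sigma[symmetric]) (auto simp: finite_decomp case_prod_unfold)
  also have "\<dots> = (\<Sum>((x, w), (y, z))\<in>(SIGMA p:decomp a (b + c) l. decomp b c (snd p)). g x y z)"
    by (rule sum.reindex_bij_witness[where i = "\<lambda>((x, w), (y, z)). ((map2 (+) x y, z), (x, y))"
          and j = "\<lambda>((w, z), (x, y)). ((x, map2 (+) y z), (y, z))"])
      (auto simp: decomp_iff sum_list_map2 map2_plus_assoc)
  also have "\<dots> = (\<Sum>(x, w)\<in>decomp a (b + c) l. \<Sum>(y, z)\<in>decomp b c w. g x y z)"
    by (subst sum.Sigma[symmetric]) (auto simp: finite_decomp case_prod_unfold)
  finally show ?thesis .
qed

context unital_algebra
begin

interpretation T: vector_space tscale
  by (rule vector_space_tscale)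

definition conv :: "nat \<Rightarrow> nat \<Rightarrow> ('k, 'a) family \<Rightarrow> ('k, 'a) family \<Rightarrow> ('k, 'a) family"
  where "conv m n G F l = (\<Sum>(x, y)\<in>decomp m n l. G x \<circ> F y)"

lemma comp_sum_eq: "comp_sum scale m n Q P = conv m n (extend scale Q) (extend scale P)"
  by (rule ext) (simp only: comp_sum_def conv_def decomp_def)

lemma diffop_comp_eq:
  "diffop_comp scale m n Q P = nondeg_part (m + n) (conv m n (extend scale Q) (extend scale P))"
  by (rule ext) (simp only: diffop_comp_def nondeg_part_def nondeg_iff comp_sum_eq)

lemma decomp_hom:
  assumes "endo m G" "endo n F" "l \<noteq> []" "(x, y) \<in> decomp m n l"
  shows "G x \<in> hom (length l) (length l)" "F y \<in> hom (length l) (length l)"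
  using assms(3,4) by (auto simp: decomp_iff intro!: endoD[OF assms(1)] endoD[OF assms(2)])

lemma conv_endo:
  assumes "endo m G" "endo n F" shows "endo (m + n) (conv m n G F)"
  unfolding endo_def conv_def
  using decomp_hom[OF assms] by (auto intro!: hom_sum hom_o)

text \<open>
  Inserting an identity is compatible with composition (\<open>iid_o\<close>), and all decompositions of
  \<open>u @ 0 # v\<close> come from decompositions of \<open>u @ v\<close>.
\<close>

lemma conv_zeros:
  assumes G: "endo m G" "zeros_act_trivially m G" and F: "endo n F" "zeros_act_trivially n F"
  shows "zeros_act_trivially (m + n) (conv m n G F)"
  unfolding zeros_act_trivially_def
proof (intro allI impI)
  fix u v :: "nat list"
  assume ne: "u @ v \<noteq> []"
  let ?d = "length (u @ v)" and ?i = "length u"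
  let ?z = "\<lambda>x. take ?i x @ 0 # drop ?i x"
  have "conv m n G F (u @ 0 # v) = (\<Sum>(x, y)\<in>decomp m n (u @ v). G (?z x) \<circ> F (?z y))"
    unfolding conv_def sum.reindex_bij_betw[OF decomp_insert_zero, symmetric] by (simp only: case_prod_unfold fst_conv snd_conv)
  also have "\<dots> = (\<Sum>p\<in>decomp m n (u @ v). iid ?d ?i (case p of (x, y) \<Rightarrow> G x \<circ> F y))"
  proof (rule sum.cong[OF refl])
    fix p assume p: "p \<in> decomp m n (u @ v)"
    obtain x y where xy: "p = (x, y)" by (cases p)
    have len: "length x = ?d" "length y = ?d" "sum_list x = m" "sum_list y = n"
      using p by (auto simp: xy decomp_iff)
    have ne': "x \<noteq> []" "y \<noteq> []" using len ne by auto
    have "G (?z x) = iid ?d ?i (G x)" "F (?z y) = iid ?d ?i (F y)"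
      using zerosD[OF G(2), of "take ?i x" "drop ?i x" ?d ?i] zerosD[OF F(2), of "take ?i y" "drop ?i y" ?d ?i] len ne'
      by auto
    then show "(case p of (x, y) \<Rightarrow> G (?z x) \<circ> F (?z y)) = iid ?d ?i (case p of (x, y) \<Rightarrow> G x \<circ> F y)"
      using iid_o[of ?i ?d "G x" "F y"] decomp_hom[OF G(1) F(1) ne, of x y] p by (simp add: xy)
  qed
  also have "\<dots> = iid ?d ?i (conv m n G F (u @ v))"
    unfolding conv_def
    by (rule iid_sum[symmetric]) (use decomp_hom[OF G(1) F(1) ne] in \<open>auto intro!: hom_o\<close>)
  finally show "conv m n G F (u @ 0 # v) = iid ?d ?i (conv m n G F (u @ v))" .
qed

text \<open>
  The multiplication moves to the left past \<open>F\<close> and then past \<open>G\<close>, splitting both components of a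
  decomposition; by \<open>sum_decomp_splits\<close> this amounts to decomposing the splittings of \<open>l\<close>.
\<close>

lemma conv_product_rule:
  assumes G: "total_diffop m G" and F: "total_diffop n F" and i: "i < length l"
  shows "product_rule (conv m n G F) l i"
proof -
  let ?d = "length l"
  let ?M = "mrg ?d i"
  have M: "?M \<in> hom (Suc ?d) ?d" by (rule mrg_hom[OF i])
  have ne: "l \<noteq> []" using i by auto
  have G1: "endo m G" and F1: "endo n F" using G F by (auto simp: total_diffop_def)
  have step: "(case p of (x, y) \<Rightarrow> G x \<circ> F y) \<circ> ?M =
      (case p of (x, y) \<Rightarrow> \<Sum>x'\<in>splits i x. \<Sum>y'\<in>splits i y. ?M \<circ> (G x' \<circ> F y'))"
    if p: "p \<in> decomp m n l" for p
  proof -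
    obtain x y where xy: "p = (x, y)" by (cases p)
    have len: "length x = ?d" "length y = ?d" "sum_list x = m" "sum_list y = n"
      using p by (auto simp: xy decomp_iff)
    have Gx: "G x \<circ> ?M = (\<Sum>x'\<in>splits i x. ?M \<circ> G x')" and Fy: "F y \<circ> ?M = (\<Sum>y'\<in>splits i y. ?M \<circ> F y')"
    proof -
      have "product_rule G x i" "product_rule F y i"
        using G F len i by (simp_all add: total_diffop_def)
      then show "G x \<circ> ?M = (\<Sum>x'\<in>splits i x. ?M \<circ> G x')" "F y \<circ> ?M = (\<Sum>y'\<in>splits i y. ?M \<circ> F y')"
        unfolding product_rule_def len .
    qed
    have Fy': "F y' \<in> hom (Suc ?d) (Suc ?d)" if "y' \<in> splits i y" for y'
      using splits_endo[OF F1 len(4) _ that] i len by simp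
    have Gx': "G x' \<in> hom (Suc ?d) (Suc ?d)" if "x' \<in> splits i x" for x'
      using splits_endo[OF G1 len(3) _ that] i len by simp
    have Gh: "G x \<in> hom ?d ?d" using decomp_hom[OF G1 F1 ne, of x y] p by (simp add: xy)
    have "(G x \<circ> F y) \<circ> ?M = G x \<circ> (\<Sum>y'\<in>splits i y. ?M \<circ> F y')"
      unfolding comp_assoc Fy ..
    also have "\<dots> = (\<Sum>y'\<in>splits i y. G x \<circ> (?M \<circ> F y'))"
      by (rule o_sum_hom[OF Gh hom_o[OF M Fy']])
    also have "\<dots> = (\<Sum>y'\<in>splits i y. \<Sum>x'\<in>splits i x. ?M \<circ> (G x' \<circ> F y'))"
      by (rule sum.cong[OF refl]) (simp only: comp_assoc[symmetric] Gx sum_o)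
    also have "\<dots> = (\<Sum>x'\<in>splits i x. \<Sum>y'\<in>splits i y. ?M \<circ> (G x' \<circ> F y'))"
      by (rule sum.swap)
    finally show ?thesis by (simp only: xy case_prod_conv)
  qed
  have "conv m n G F l \<circ> ?M =
      (\<Sum>(x, y)\<in>decomp m n l. \<Sum>x'\<in>splits i x. \<Sum>y'\<in>splits i y. ?M \<circ> (G x' \<circ> F y'))"
    unfolding conv_def sum_o by (rule sum.cong[OF refl step])
  also have "\<dots> = (\<Sum>k\<in>splits i l. \<Sum>(x', y')\<in>decomp m n k. ?M \<circ> (G x' \<circ> F y'))"
    by (rule sum_decomp_splits[OF i])
  also have "\<dots> = (\<Sum>k\<in>splits i l. ?M \<circ> conv m n G F k)"
  proof (rule sum.cong[OF refl])
    fix k assume k: "k \<in> splits i l"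
    then have len: "length k = Suc ?d" and "k \<noteq> []" by (auto simp: splits_def)
    have "(case p of (x, y) \<Rightarrow> G x \<circ> F y) \<in> hom (Suc ?d) (Suc ?d)" if "p \<in> decomp m n k" for p
      using decomp_hom[OF G1 F1 \<open>k \<noteq> []\<close>, of "fst p" "snd p"] that len
      by (auto simp: case_prod_unfold intro!: hom_o)
    then have "?M \<circ> conv m n G F k = (\<Sum>p\<in>decomp m n k. ?M \<circ> (case p of (x, y) \<Rightarrow> G x \<circ> F y))"
      unfolding conv_def by (rule o_sum_hom[OF M])
    then show "(\<Sum>(x', y')\<in>decomp m n k. ?M \<circ> (G x' \<circ> F y')) = ?M \<circ> conv m n G F k"
      by (simp only: case_prod_unfold)
  qed
  finally show ?thesis unfolding product_rule_def .
qed

lemma conv_total: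
  assumes G: "total_diffop m G" and F: "total_diffop n F"
  shows "total_diffop (m + n) (conv m n G F)"
proof -
  have "\<exists>c. conv m n G F [0] = (\<lambda>t. tscale c (tid scale 1 t))" if "m + n = 0"
  proof -
    from that G F obtain c c' where
      c: "G [0] = (\<lambda>t. tscale c (tid scale 1 t))" "F [0] = (\<lambda>t. tscale c' (tid scale 1 t))"
      by (auto simp: total_diffop_def)
    have "decomp m n [0] = {([0], [0])}"
      using that by (auto simp: decomp_def opart_def length_Suc_conv)
    then have "conv m n G F [0] = G [0] \<circ> F [0]" by (simp add: conv_def)
    also have "\<dots> = (\<lambda>t. tscale c' ((G [0] \<circ> tid scale 1) t))"
      unfolding c(2) by (rule o_tscale_hom[of _ 1 1, OF _ tid_hom]) (unfold c(1), rule hom_tscale[OF tid_hom])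
    also have "\<dots> = (\<lambda>t. tscale (c' * c) (tid scale 1 t))"
    proof -
      have "tid scale 1 (tid scale 1 t) = tid scale 1 t" for t
        using fun_cong[OF tid_o[OF tid_hom[of 1]], of t] by (simp only: o_apply)
      then show ?thesis unfolding c(1) by (simp only: o_apply T.scale_scale)
    qed
    finally show ?thesis by blast
  qed
  then show ?thesis
    using conv_endo conv_zeros conv_product_rule[OF G F] G F
    unfolding total_diffop_def by blast
qed

lemma diffop_comp_diffop:
  assumes "P \<in> diffop scale n" "Q \<in> diffop scale m"
  shows "diffop_comp scale m n Q P \<in> diffop scale (m + n)"
  unfolding diffop_comp_eq using assms by (intro nondeg_part_diffop conv_total extend_total)

lemma extend_diffop_comp:
  assumes "P \<in> diffop scale n" "Q \<in> diffop scale m" "l \<noteq> []" "sum_list l = m + n"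
  shows "extend scale (diffop_comp scale m n Q P) l = conv m n (extend scale Q) (extend scale P) l"
  unfolding diffop_comp_eq
  using conv_total[OF extend_total[OF assms(2)] extend_total[OF assms(1)]] assms(3,4)
  by (intro extend_nondeg_part) (auto simp: total_diffop_def)

lemma conv_cong:
  assumes "\<And>x. x \<noteq> [] \<Longrightarrow> sum_list x = m \<Longrightarrow> G x = G' x"
    and "\<And>y. y \<noteq> [] \<Longrightarrow> sum_list y = n \<Longrightarrow> F y = F' y" and "l \<noteq> []"
  shows "conv m n G F l = conv m n G' F' l"
  unfolding conv_def
proof (rule sum.cong[OF refl])
  fix p assume "p \<in> decomp m n l"
  then have "length (fst p) = length l" "sum_list (fst p) = m" "length (snd p) = length l" "sum_list (snd p) = n"
    by (cases p; simp add: decomp_iff)+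
  then have "G (fst p) = G' (fst p)" "F (snd p) = F' (snd p)"
    using assms(3) assms(1)[of "fst p"] assms(2)[of "snd p"] by force+
  then show "(case p of (x, y) \<Rightarrow> G x \<circ> F y) = (case p of (x, y) \<Rightarrow> G' x \<circ> F' y)"
    by (simp only: case_prod_unfold)
qed

lemma conv_assoc:
  assumes H: "endo a H" and G: "endo b G" and F: "endo c F" and l: "l \<noteq> []"
  shows "conv (a + b) c (conv a b H G) F l = conv a (b + c) H (conv b c G F) l"
proof -
  have "conv (a + b) c (conv a b H G) F l =
      (\<Sum>(w, z)\<in>decomp (a + b) c l. \<Sum>(x, y)\<in>decomp a b w. H x \<circ> (G y \<circ> F z))"
    unfolding conv_def sum_o by (simp only: case_prod_unfold comp_assoc)
  also have "\<dots> = (\<Sum>(x, w)\<in>decomp a (b + c) l. \<Sum>(y, z)\<in>decomp b c w. H x \<circ> (G y \<circ> F z))"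
    by (rule sum_decomp_assoc)
  also have "\<dots> = conv a (b + c) H (conv b c G F) l"
    unfolding conv_def
  proof (rule sum.cong[OF refl])
    fix p assume p: "p \<in> decomp a (b + c) l"
    obtain x w where xw: "p = (x, w)" by (cases p)
    have w: "length w = length l" "w \<noteq> []" and Hx: "H x \<in> hom (length l) (length l)"
      using p l by (auto simp: xw decomp_iff intro!: endoD[OF H])
    have "(case q of (y, z) \<Rightarrow> G y \<circ> F z) \<in> hom (length l) (length l)" if "q \<in> decomp b c w" for q
      using decomp_hom[OF G F w(2), of "fst q" "snd q"] that w(1) by (auto simp: case_prod_unfold intro!: hom_o)
    then have "H x \<circ> (\<Sum>q\<in>decomp b c w. case q of (y, z) \<Rightarrow> G y \<circ> F z) =
        (\<Sum>q\<in>decomp b c w. H x \<circ> (case q of (y, z) \<Rightarrow> G y \<circ> F z))"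
      by (rule o_sum_hom[OF Hx])
    then show "(case p of (x, w) \<Rightarrow> \<Sum>(y, z)\<in>decomp b c w. H x \<circ> (G y \<circ> F z)) =
        (case p of (x, w) \<Rightarrow> H x \<circ> (\<Sum>(y, z)\<in>decomp b c w. G y \<circ> F z))"
      unfolding xw by (simp only: case_prod_unfold fst_conv snd_conv)
  qed
  finally show ?thesis .
qed

definition identity_family :: "('k, 'a) family"
  where "identity_family l = tid scale (length l)"

text \<open>The only partition of \<open>0\<close> of a given length is the list of zeros.\<close>

lemma conv_unit:
  assumes F: "endo n F" and l: "l \<noteq> []" "sum_list l = n"
  shows "conv 0 n identity_family F l = F l" "conv n 0 F identity_family l = F l"
proof -
  have Fl: "F l \<in> hom (length l) (length l)" using F l by (intro endoD) auto
  let ?z = "replicate (length l) (0 :: nat)"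
  have z: "x = ?z \<longleftrightarrow> length x = length l \<and> sum_list x = 0" for x :: "nat list"
    by (auto simp: sum_list_eq_0_iff replicate_length_same intro: replicate_eqI)
  have add: "map2 (+) ?z y = y" "map2 (+) y ?z = y" if "length y = length l" for y
    using that by (auto simp: list_eq_iff_nth_eq)
  have "(x, y) \<in> decomp 0 n l \<longleftrightarrow> x = ?z \<and> y = l" for x y
  proof
    assume xy: "(x, y) \<in> decomp 0 n l"
    then have "x = ?z" unfolding z by (simp only: decomp_iff)
    then show "x = ?z \<and> y = l" using xy add(1)[of y] by (simp only: decomp_iff)
  qed (use l(2) add in \<open>simp add: decomp_iff\<close>)
  moreover have "(x, y) \<in> decomp n 0 l \<longleftrightarrow> x = l \<and> y = ?z" for x y
  proof
    assume xy: "(x, y) \<in> decomp n 0 l"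
    then have "y = ?z" unfolding z by (simp only: decomp_iff)
    then show "x = l \<and> y = ?z" using xy add(2)[of x] by (simp only: decomp_iff)
  qed (use l(2) add in \<open>simp add: decomp_iff\<close>)
  ultimately have "decomp 0 n l = {(?z, l)}" "decomp n 0 l = {(l, ?z)}" by auto
  then show "conv 0 n identity_family F l = F l" "conv n 0 F identity_family l = F l"
    using tid_o[OF Fl] o_tid[OF Fl] by (simp_all add: conv_def identity_family_def)
qed

section \<open>Linear structure\<close>

definition fscale :: "'k \<Rightarrow> ('k, 'a) family \<Rightarrow> ('k, 'a) family"
  where "fscale c F l t = tscale c (F l t)"

lemma fscale_apply: "fscale c F l = (\<lambda>t. tscale c (F l t))"
  by (rule ext) (rule fscale_def)

lemma o_zero:
  assumes "h \<in> hom d e" shows "h \<circ> 0 = 0"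
  by (rule ext) (simp only: o_apply zero_fun_apply thom_zero[OF assms])

lemma zero_o: "(0 :: 'x \<Rightarrow> 'y::zero) \<circ> h = 0"
  by (rule ext) (simp only: o_apply zero_fun_apply)

lemma add_o: "(f + g) \<circ> h = (f \<circ> h) + (g \<circ> h)"
  by (rule ext) (simp only: o_apply plus_fun_apply)

lemma tscale_sum: "tscale c (\<Sum>x\<in>S. f x) = (\<Sum>x\<in>S. tscale c (f x))"
  by (rule T.scale_sum_right)

text \<open>
  The pointwise rules restricted to the type of families.  Linear maps and tensors are functions
  too, and rewriting with the general rules would also break up their sums.
\<close>

lemma family_plus: "((F :: ('k, 'a) family) + G) l = F l + G l"
  by (rule plus_fun_apply)

lemma family_zero: "(0 :: ('k, 'a) family) l = 0"
  by (rule zero_fun_apply)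

lemma total_zero: "total_diffop n 0"
proof -
  have "product_rule 0 l i" if "i < length l" for l i
    unfolding product_rule_def
    by (simp only: family_zero zero_o o_zero[OF mrg_hom[OF that]] sum.neutral_const)
  moreover have "\<exists>c. (0 :: ('k, 'a) family) [0] = (\<lambda>t. tscale c (tid scale 1 t))"
    by (rule exI[of _ 0]) (simp only: T.scale_zero_left zero_fun_def)
  moreover have "endo n 0" "zeros_act_trivially n 0"
    unfolding endo_def zeros_act_trivially_def family_zero
    by (simp_all only: hom_zero iid_zero length_append le_add1 simp_thms)
  ultimately show ?thesis unfolding total_diffop_def by blast
qed

lemma total_add:
  assumes F: "total_diffop n F" and G: "total_diffop n G"
  shows "total_diffop n (F + G)"
proof -
  have F1: "endo n F" and G1: "endo n G" using F G by (auto simp: total_diffop_def)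
  have "product_rule (F + G) l i" if "sum_list l = n" "i < length l" for l i
  proof -
    let ?M = "mrg (length l) i"
    have "product_rule F l i" "product_rule G l i" using that F G by (auto simp: total_diffop_def)
    then have "(F l + G l) \<circ> ?M = (\<Sum>k\<in>splits i l. (?M \<circ> F k) + (?M \<circ> G k))"
      unfolding add_o product_rule_def sum.distrib by (simp only:)
    also have "\<dots> = (\<Sum>k\<in>splits i l. ?M \<circ> (F k + G k))"
      by (rule sum.cong[OF refl])
        (rule o_add_hom[symmetric, OF mrg_hom[OF that(2)] splits_endo[OF F1 that] splits_endo[OF G1 that]])
    finally show ?thesis unfolding product_rule_def family_plus .
  qed
  moreover have "endo n (F + G)"
    unfolding endo_def family_plus
    by (intro allI impI hom_add endoD[OF F1] endoD[OF G1] refl)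
  moreover have "zeros_act_trivially n (F + G)"
    unfolding zeros_act_trivially_def family_plus
  proof (intro allI impI)
    fix u v :: "nat list" assume uv: "u @ v \<noteq> []" "sum_list (u @ v) = n"
    have "F (u @ v) \<in> hom (length (u @ v)) (length (u @ v))" "G (u @ v) \<in> hom (length (u @ v)) (length (u @ v))"
      using endoD[OF F1 uv refl] endoD[OF G1 uv refl] .
    from iid_add[OF _ this, of "length u"] uv F G
    show "F (u @ 0 # v) + G (u @ 0 # v) = iid (length (u @ v)) (length u) (F (u @ v) + G (u @ v))"
      unfolding total_diffop_def zeros_act_trivially_def by simp
  qed
  moreover have "\<exists>c. (F + G) [0] = (\<lambda>t. tscale c (tid scale 1 t))" if n: "n = 0"
  proof -
    from n F G obtain c c' where c: "F [0] = (\<lambda>t. tscale c (tid scale 1 t))" "G [0] = (\<lambda>t. tscale c' (tid scale 1 t))"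
      by (auto simp: total_diffop_def)
    show ?thesis
      by (rule exI[of _ "c + c'"], rule ext) (simp only: plus_fun_apply c T.scale_left_distrib)
  qed
  ultimately show ?thesis unfolding total_diffop_def by blast
qed

lemma total_fscale:
  assumes F: "total_diffop n F"
  shows "total_diffop n (fscale c F)"
proof -
  have F1: "endo n F" using F by (auto simp: total_diffop_def)
  have "product_rule (fscale c F) l i" if "sum_list l = n" "i < length l" for l i
  proof -
    let ?M = "mrg (length l) i"
    have pr: "F l \<circ> ?M = (\<Sum>k\<in>splits i l. ?M \<circ> F k)" using that F by (auto simp: total_diffop_def product_rule_def)
    have "fscale c F l \<circ> ?M = (\<lambda>t. tscale c ((F l \<circ> ?M) t))"
      unfolding fscale_apply by (simp only: o_def)
    also have "\<dots> = (\<Sum>k\<in>splits i l. (\<lambda>t. tscale c ((?M \<circ> F k) t)))"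
      by (rule ext) (simp only: pr sum_fun_apply tscale_sum)
    also have "\<dots> = (\<Sum>k\<in>splits i l. ?M \<circ> fscale c F k)"
      unfolding fscale_apply by (rule sum.cong[OF refl])
        (rule o_tscale_hom[symmetric, OF mrg_hom[OF that(2)] splits_endo[OF F1 that]])
    finally show ?thesis unfolding product_rule_def .
  qed
  moreover have "endo n (fscale c F)"
    using F1 unfolding endo_def fscale_apply by (auto intro: hom_tscale)
  moreover have "zeros_act_trivially n (fscale c F)"
    unfolding zeros_act_trivially_def fscale_apply
  proof (intro allI impI)
    fix u v :: "nat list" assume uv: "u @ v \<noteq> []" "sum_list (u @ v) = n"
    from iid_tscale[OF _ endoD[OF F1 uv refl], of "length u" c] uv F
    show "(\<lambda>t. tscale c (F (u @ 0 # v) t)) = iid (length (u @ v)) (length u) (\<lambda>t. tscale c (F (u @ v) t))"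
      unfolding total_diffop_def zeros_act_trivially_def by simp
  qed
  moreover have "\<exists>b. fscale c F [0] = (\<lambda>t. tscale b (tid scale 1 t))" if n: "n = 0"
  proof -
    from n F obtain b where b: "F [0] = (\<lambda>t. tscale b (tid scale 1 t))"
      by (auto simp: total_diffop_def)
    show ?thesis
      by (rule exI[of _ "c * b"], rule ext) (simp only: fscale_apply b T.scale_scale)
  qed
  ultimately show ?thesis unfolding total_diffop_def by blast
qed

lemma total_identity_family: "total_diffop 0 identity_family"
proof -
  have "product_rule identity_family l i" if l: "sum_list l = 0" and i: "i < length l" for l i
  proof -
    obtain u m v where lu: "l = u @ m # v" "length u = i" using i by (rule list_split_at)
    have "m = 0" using l lu by simp
    have "(\<Sum>k\<in>splits i l. mrg (length l) i \<circ> identity_family k) = mrg (length l) i \<circ> identity_family (u @ 0 # 0 # v)"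
      using sum_splits[OF lu(2), of "\<lambda>k. mrg (length l) i \<circ> identity_family k" 0 v] by (simp add: lu(1) \<open>m = 0\<close>)
    also have "identity_family (u @ 0 # 0 # v) = tid scale (Suc (length l))" by (simp add: identity_family_def lu(1))
    finally have "(\<Sum>k\<in>splits i l. mrg (length l) i \<circ> identity_family k) = mrg (length l) i \<circ> tid scale (Suc (length l))" .
    then show ?thesis
      unfolding product_rule_def by (simp only: identity_family_def[of l] tid_o[OF mrg_hom[OF i]] o_tid[OF mrg_hom[OF i]])
  qed
  moreover have "zeros_act_trivially 0 identity_family"
    unfolding zeros_act_trivially_def identity_family_def by (simp add: iid_tid)
  moreover have "endo 0 identity_family" by (simp add: endo_def identity_family_def tid_hom)
  moreover have "\<exists>c. identity_family [0] = (\<lambda>t. tscale c (tid scale 1 t))"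
    by (rule exI[of _ 1], rule ext) (simp add: identity_family_def)
  ultimately show ?thesis unfolding total_diffop_def by blast
qed

lemma nondeg_part_add: "nondeg_part n (F + G) = nondeg_part n F + nondeg_part n G"
  by (rule ext) (simp add: nondeg_part_def)

lemma nondeg_part_zero: "nondeg_part n 0 = 0"
  by (rule ext) (simp add: nondeg_part_def)

lemma nondeg_part_fscale: "nondeg_part n (fscale c F) = fscale c (nondeg_part n F)"
  by (rule ext) (auto simp: nondeg_part_def fscale_apply tscale_def fun_eq_iff)

lemma nondeg_part_cong:
  "(\<And>l. l \<noteq> [] \<Longrightarrow> sum_list l = n \<Longrightarrow> F l = G l) \<Longrightarrow> nondeg_part n F = nondeg_part n G"
  by (rule ext) (simp add: nondeg_part_def nondeg_def)

lemma diffop_zero: "0 \<in> diffop scale n"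
  using nondeg_part_diffop[OF total_zero] by (simp only: nondeg_part_zero)

lemma extend_zero:
  assumes "l \<noteq> []" shows "extend scale 0 l = 0"
proof -
  have "zeros_act_trivially (sum_list l) 0"
    using total_zero unfolding total_diffop_def by blast
  from extend_nondeg_part[OF this assms refl] show ?thesis
    by (simp only: nondeg_part_zero family_zero)
qed

text \<open>
  Extending is inverse to taking the nondegenerate part, and the latter is linear; so sums and
  multiples of operators can be formed on the extensions.
\<close>

lemma
  assumes P: "P \<in> diffop scale n" and Q: "Q \<in> diffop scale n"
  shows diffop_add: "P + Q \<in> diffop scale n"
    and extend_add: "l \<noteq> [] \<Longrightarrow> sum_list l = n \<Longrightarrow> extend scale (P + Q) l = extend scale P l + extend scale Q l"
proof -
  let ?F = "extend scale P + extend scale Q"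
  have F: "total_diffop n ?F" by (rule total_add[OF extend_total[OF P] extend_total[OF Q]])
  have eq: "nondeg_part n ?F = P + Q"
    unfolding nondeg_part_add nondeg_part_extend[OF P] nondeg_part_extend[OF Q] ..
  show "P + Q \<in> diffop scale n" using nondeg_part_diffop[OF F] unfolding eq .
  show "extend scale (P + Q) l = extend scale P l + extend scale Q l" if "l \<noteq> []" "sum_list l = n"
    using extend_nondeg_part[of n ?F l] that F unfolding eq total_diffop_def family_plus by blast
qed

lemma
  assumes P: "P \<in> diffop scale n"
  shows diffop_fscale: "fscale c P \<in> diffop scale n"
    and extend_fscale: "l \<noteq> [] \<Longrightarrow> sum_list l = n \<Longrightarrow> extend scale (fscale c P) l = fscale c (extend scale P) l"
proof -
  let ?F = "fscale c (extend scale P)"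
  have F: "total_diffop n ?F" by (rule total_fscale[OF extend_total[OF P]])
  have eq: "nondeg_part n ?F = fscale c P"
    unfolding nondeg_part_fscale nondeg_part_extend[OF P] ..
  show "fscale c P \<in> diffop scale n" using nondeg_part_diffop[OF F] unfolding eq .
  show "extend scale (fscale c P) l = ?F l" if "l \<noteq> []" "sum_list l = n"
    using extend_nondeg_part[of n ?F l] that F unfolding eq total_diffop_def by blast
qed

lemma one_eq: "DA_one scale 0 = nondeg_part 0 identity_family"
  by (rule ext) (auto simp: DA_one_def nondeg_part_def nondeg_def degenerate_def identity_family_def length_Suc_conv
      neq_Nil_conv)

lemma diffop_one: "DA_one scale 0 \<in> diffop scale 0"
  unfolding one_eq by (rule nondeg_part_diffop[OF total_identity_family])

lemma extend_one: "l \<noteq> [] \<Longrightarrow> sum_list l = 0 \<Longrightarrow> extend scale (DA_one scale 0) l = identity_family l"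
  unfolding one_eq using total_identity_family by (intro extend_nondeg_part) (auto simp: total_diffop_def)

lemma diffop_sum: "(\<And>x. x \<in> S \<Longrightarrow> f x \<in> diffop scale n) \<Longrightarrow> (\<Sum>x\<in>S. f x) \<in> diffop scale n"
  by (induction S rule: infinite_finite_induct) (simp_all add: diffop_zero diffop_add)

lemma comp_one_left:
  assumes "P \<in> diffop scale n" shows "diffop_comp scale 0 n (DA_one scale 0) P = P"
proof -
  have E: "endo n (extend scale P)" using extend_total[OF assms] by (simp add: total_diffop_def)
  have "diffop_comp scale 0 n (DA_one scale 0) P = nondeg_part n (extend scale P)"
    unfolding diffop_comp_eq add_0
    by (rule nondeg_part_cong)
      (use conv_unit(1)[OF E] conv_cong[of 0 "extend scale (DA_one scale 0)" identity_family n "extend scale P"] extend_one in metis)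
  then show ?thesis by (simp only: nondeg_part_extend[OF assms])
qed

lemma comp_one_right:
  assumes "P \<in> diffop scale n" shows "diffop_comp scale n 0 P (DA_one scale 0) = P"
proof -
  have E: "endo n (extend scale P)" using extend_total[OF assms] by (simp add: total_diffop_def)
  have "diffop_comp scale n 0 P (DA_one scale 0) = nondeg_part n (extend scale P)"
    unfolding diffop_comp_eq add_0_right
    by (rule nondeg_part_cong)
      (use conv_unit(2)[OF E] conv_cong[of n "extend scale P" "extend scale P" 0 "extend scale (DA_one scale 0)" identity_family] extend_one in metis)
  then show ?thesis by (simp only: nondeg_part_extend[OF assms])
qed

lemma comp_assoc_diffop:
  assumes "H \<in> diffop scale a" "G \<in> diffop scale b" "F \<in> diffop scale c"
  shows "diffop_comp scale (a + b) c (diffop_comp scale a b H G) F =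
    diffop_comp scale a (b + c) H (diffop_comp scale b c G F)"
proof -
  let ?H = "extend scale H" and ?G = "extend scale G" and ?F = "extend scale F"
  have e: "endo a ?H" "endo b ?G" "endo c ?F"
    using assms[THEN extend_total] by (auto simp: total_diffop_def)
  have "conv (a + b) c (extend scale (diffop_comp scale a b H G)) ?F l =
      conv a (b + c) ?H (extend scale (diffop_comp scale b c G F)) l" if l: "l \<noteq> []" for l
  proof -
    have "conv (a + b) c (extend scale (diffop_comp scale a b H G)) ?F l =
        conv (a + b) c (conv a b ?H ?G) ?F l"
      by (rule conv_cong[OF extend_diffop_comp refl l]) (use assms in auto)
    also have "\<dots> = conv a (b + c) ?H (conv b c ?G ?F) l"
      by (rule conv_assoc[OF e l])
    also have "\<dots> = conv a (b + c) ?H (extend scale (diffop_comp scale b c G F)) l"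
      by (rule conv_cong[OF refl extend_diffop_comp[symmetric] l]) (use assms in auto)
    finally show ?thesis .
  qed
  then show ?thesis
    unfolding diffop_comp_eq[of "a + b"] diffop_comp_eq[of a "b + c"] add.assoc
    by (intro nondeg_part_cong)
qed

lemma comp_zero_left: "diffop_comp scale m n 0 P = 0"
proof -
  have "conv m n (extend scale 0) (extend scale P) l = 0" if "l \<noteq> []" for l
  proof -
    have "conv m n (extend scale 0) (extend scale P) l = conv m n 0 (extend scale P) l"
      by (rule conv_cong[OF _ refl that]) (simp only: extend_zero family_zero simp_thms)
    also have "\<dots> = 0" by (simp only: conv_def family_zero zero_o case_prod_unfold sum.neutral_const)
    finally show ?thesis .
  qed
  then have "diffop_comp scale m n 0 P = nondeg_part (m + n) 0"
    unfolding diffop_comp_eq by (intro nondeg_part_cong) (simp only: family_zero)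
  then show ?thesis by (simp only: nondeg_part_zero)
qed

lemma comp_zero_right:
  assumes "Q \<in> diffop scale m" shows "diffop_comp scale m n Q 0 = 0"
proof -
  have e: "endo m (extend scale Q)" using extend_total[OF assms] by (simp add: total_diffop_def)
  have "conv m n (extend scale Q) (extend scale 0) l = 0" if "l \<noteq> []" for l
  proof -
    have "conv m n (extend scale Q) (extend scale 0) l = conv m n (extend scale Q) 0 l"
      by (rule conv_cong[OF refl _ that]) (simp only: extend_zero family_zero simp_thms)
    also have "\<dots> = (\<Sum>p\<in>decomp m n l. 0)"
      unfolding conv_def
    proof (rule sum.cong[OF refl])
      fix p assume "p \<in> decomp m n l"
      then have "(fst p, snd p) \<in> decomp m n l" by simp
      then have "length (fst p) = length l \<and> sum_list (fst p) = m" by (simp only: decomp_iff)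
      then have "extend scale Q (fst p) \<in> hom (length l) (length l)"
        using that by (intro endoD[OF e]) auto
      then show "(case p of (x, y) \<Rightarrow> extend scale Q x \<circ> (0 :: ('k, 'a) family) y) = 0"
        by (simp only: case_prod_unfold family_zero o_zero)
    qed
    also have "\<dots> = 0" by (rule sum.neutral_const)
    finally show ?thesis .
  qed
  then have "diffop_comp scale m n Q 0 = nondeg_part (m + n) 0"
    unfolding diffop_comp_eq by (intro nondeg_part_cong) (simp only: family_zero)
  then show ?thesis by (simp only: nondeg_part_zero)
qed

lemma comp_add_left:
  assumes "Q \<in> diffop scale m" "Q' \<in> diffop scale m"
  shows "diffop_comp scale m n (Q + Q') P = diffop_comp scale m n Q P + diffop_comp scale m n Q' P"
proof -
  let ?P = "extend scale P"
  have "conv m n (extend scale (Q + Q')) ?P l =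
      (conv m n (extend scale Q) ?P + conv m n (extend scale Q') ?P) l" if "l \<noteq> []" for l
  proof -
    have "conv m n (extend scale (Q + Q')) ?P l = conv m n (extend scale Q + extend scale Q') ?P l"
      by (rule conv_cong[OF _ refl that]) (simp only: extend_add[OF assms] family_plus simp_thms)
    also have "\<dots> = conv m n (extend scale Q) ?P l + conv m n (extend scale Q') ?P l"
      by (simp only: conv_def family_plus add_o case_prod_unfold sum.distrib)
    finally show ?thesis by (simp only: family_plus)
  qed
  then show ?thesis
    unfolding diffop_comp_eq nondeg_part_add[symmetric] by (intro nondeg_part_cong)
qed

lemma comp_add_right:
  assumes "Q \<in> diffop scale m" "P \<in> diffop scale n" "P' \<in> diffop scale n"
  shows "diffop_comp scale m n Q (P + P') = diffop_comp scale m n Q P + diffop_comp scale m n Q P'"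
proof -
  let ?Q = "extend scale Q" and ?P = "extend scale P" and ?P' = "extend scale P'"
  have e: "endo m ?Q" "endo n ?P" "endo n ?P'"
    using assms[THEN extend_total] by (auto simp: total_diffop_def)
  have "conv m n ?Q (extend scale (P + P')) l = (conv m n ?Q ?P + conv m n ?Q ?P') l" if l: "l \<noteq> []" for l
  proof -
    have "conv m n ?Q (extend scale (P + P')) l = conv m n ?Q (?P + ?P') l"
      by (rule conv_cong[OF refl _ that]) (simp only: extend_add[OF assms(2,3)] family_plus simp_thms)
    also have "\<dots> = (\<Sum>p\<in>decomp m n l. (?Q (fst p) \<circ> ?P (snd p)) + (?Q (fst p) \<circ> ?P' (snd p)))"
      unfolding conv_def
    proof (rule sum.cong[OF refl])
      fix p assume "p \<in> decomp m n l"
      then have "(fst p, snd p) \<in> decomp m n l" by simp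
      note h = decomp_hom[OF e(1,2) l this] decomp_hom[OF e(1,3) l this]
      show "(case p of (x, y) \<Rightarrow> ?Q x \<circ> (?P + ?P') y) =
          (?Q (fst p) \<circ> ?P (snd p)) + (?Q (fst p) \<circ> ?P' (snd p))"
        unfolding case_prod_unfold family_plus by (rule o_add_hom[OF h(1,2,4)])
    qed
    also have "\<dots> = conv m n ?Q ?P l + conv m n ?Q ?P' l"
      by (simp only: conv_def case_prod_unfold sum.distrib)
    finally show ?thesis by (simp only: family_plus)
  qed
  then show ?thesis
    unfolding diffop_comp_eq nondeg_part_add[symmetric] by (intro nondeg_part_cong)
qed

lemma comp_fscale_left:
  assumes "Q \<in> diffop scale m"
  shows "diffop_comp scale m n (fscale c Q) P = fscale c (diffop_comp scale m n Q P)"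
proof -
  let ?P = "extend scale P"
  have "conv m n (extend scale (fscale c Q)) ?P l = fscale c (conv m n (extend scale Q) ?P) l" if "l \<noteq> []" for l
  proof -
    have "conv m n (extend scale (fscale c Q)) ?P l = conv m n (fscale c (extend scale Q)) ?P l"
      by (rule conv_cong[OF _ refl that]) (rule extend_fscale[OF assms])
    also have "\<dots> = fscale c (conv m n (extend scale Q) ?P) l"
      by (rule ext) (simp only: conv_def fscale_def sum_fun_apply tscale_sum case_prod_unfold o_apply)
    finally show ?thesis .
  qed
  then show ?thesis
    unfolding diffop_comp_eq nondeg_part_fscale[symmetric] by (intro nondeg_part_cong)
qed

lemma comp_fscale_right:
  assumes "Q \<in> diffop scale m" "P \<in> diffop scale n"
  shows "diffop_comp scale m n Q (fscale c P) = fscale c (diffop_comp scale m n Q P)"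
proof -
  let ?Q = "extend scale Q" and ?P = "extend scale P"
  have e: "endo m ?Q" "endo n ?P"
    using assms[THEN extend_total] by (auto simp: total_diffop_def)
  have "conv m n ?Q (extend scale (fscale c P)) l = fscale c (conv m n ?Q ?P) l" if l: "l \<noteq> []" for l
  proof -
    have "conv m n ?Q (extend scale (fscale c P)) l = conv m n ?Q (fscale c ?P) l"
      by (rule conv_cong[OF refl _ that]) (rule extend_fscale[OF assms(2)])
    also have "\<dots> = (\<Sum>p\<in>decomp m n l. (\<lambda>t. tscale c ((?Q (fst p) \<circ> ?P (snd p)) t)))"
      unfolding conv_def
    proof (rule sum.cong[OF refl])
      fix p assume "p \<in> decomp m n l"
      then have "(fst p, snd p) \<in> decomp m n l" by simp
      from o_tscale_hom[OF decomp_hom[OF e l this]]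
      show "(case p of (x, y) \<Rightarrow> ?Q x \<circ> fscale c ?P y) = (\<lambda>t. tscale c ((?Q (fst p) \<circ> ?P (snd p)) t))"
        unfolding case_prod_unfold fscale_apply .
    qed
    also have "\<dots> = fscale c (conv m n ?Q ?P) l"
      by (rule ext) (simp only: conv_def fscale_def sum_fun_apply tscale_sum case_prod_unfold)
    finally show ?thesis .
  qed
  then show ?thesis
    unfolding diffop_comp_eq nondeg_part_fscale[symmetric] by (intro nondeg_part_cong)
qed

lemma comp_sum_left:
  assumes "\<And>x. x \<in> S \<Longrightarrow> f x \<in> diffop scale m"
  shows "diffop_comp scale m n (\<Sum>x\<in>S. f x) P = (\<Sum>x\<in>S. diffop_comp scale m n (f x) P)"
  using assms
  by (induction S rule: infinite_finite_induct) (simp_all add: comp_zero_left comp_add_left diffop_sum)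

lemma comp_sum_right:
  assumes "Q \<in> diffop scale m" "\<And>x. x \<in> S \<Longrightarrow> f x \<in> diffop scale n"
  shows "diffop_comp scale m n Q (\<Sum>x\<in>S. f x) = (\<Sum>x\<in>S. diffop_comp scale m n Q (f x))"
  using assms(2)
  by (induction S rule: infinite_finite_induct)
    (simp_all add: comp_zero_right[OF assms(1)] comp_add_right[OF assms(1)] diffop_sum)

section \<open>The graded algebra\<close>

lemma vector_space_DA: "vector_space (DA_scale :: 'k \<Rightarrow> (nat \<Rightarrow> ('k, 'a) family) \<Rightarrow> _)"
  by unfold_locales (intro ext, simp add: DA_scale_def tscale_def algebra_simps)+

lemma DA_scale_eq: "DA_scale c F n = fscale c (F n)"
  by (intro ext) (simp only: DA_scale_def fscale_def)

lemma DA_diffop: "F \<in> DA scale \<Longrightarrow> F n \<in> diffop scale n"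
  by (simp add: DA_def)

lemma subspace_DA: "module.subspace DA_scale (DA scale)"
proof -
  interpret D: vector_space "DA_scale :: 'k \<Rightarrow> (nat \<Rightarrow> ('k, 'a) family) \<Rightarrow> _"
    by (rule vector_space_DA)
  show ?thesis
  proof (rule D.subspaceI)
    show "0 \<in> DA scale"
      by (simp add: DA_def diffop_zero)
    fix F G assume F: "F \<in> DA scale" and G: "G \<in> DA scale"
    have "{n. (F + G) n \<noteq> 0} \<subseteq> {n. F n \<noteq> 0} \<union> {n. G n \<noteq> 0}" by auto
    then have "finite {n. (F + G) n \<noteq> 0}"
      using F G by (auto simp: DA_def intro: finite_subset)
    then show "F + G \<in> DA scale" using F G by (simp add: DA_def diffop_add)
  next
    fix c F assume F: "F \<in> DA scale"
    have "{n. DA_scale c F n \<noteq> 0} \<subseteq> {n. F n \<noteq> 0}"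
      by (auto simp: DA_scale_def tscale_def fun_eq_iff)
    then have "finite {n. DA_scale c F n \<noteq> 0}"
      using F by (auto simp: DA_def intro: finite_subset)
    then show "DA_scale c F \<in> DA scale"
      using F by (simp add: DA_def DA_scale_eq diffop_fscale)
  qed
qed

lemma fscale_sum: "fscale c (\<Sum>x\<in>S. f x) = (\<Sum>x\<in>S. fscale c (f x))"
  by (intro ext) (simp only: fscale_def sum_fun_apply tscale_sum)

lemma mult_diffop:
  assumes "G \<in> DA scale" "F \<in> DA scale" "m \<le> N"
  shows "diffop_comp scale m (N - m) (G m) (F (N - m)) \<in> diffop scale N"
  using diffop_comp_diffop[OF DA_diffop[OF assms(2)] DA_diffop[OF assms(1)], of m "N - m"] assms(3) by simp

lemma DA_mult_closed:
  assumes G: "G \<in> DA scale" and F: "F \<in> DA scale"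
  shows "DA_mult scale G F \<in> DA scale"
proof -
  have "DA_mult scale G F N \<in> diffop scale N" for N
    unfolding DA_mult_def by (rule diffop_sum) (use mult_diffop[OF G F] in simp)
  moreover have "{N. DA_mult scale G F N \<noteq> 0} \<subseteq> (\<lambda>(m, n). m + n) ` ({m. G m \<noteq> 0} \<times> {n. F n \<noteq> 0})"
  proof
    fix N assume "N \<in> {N. DA_mult scale G F N \<noteq> 0}"
    then obtain m where m: "m \<le> N" "diffop_comp scale m (N - m) (G m) (F (N - m)) \<noteq> 0"
      unfolding DA_mult_def by (metis (mono_tags, lifting) atMost_iff mem_Collect_eq sum.neutral)
    then have "G m \<noteq> 0" "F (N - m) \<noteq> 0"
      using comp_zero_left comp_zero_right[OF DA_diffop[OF G]] by metis+
    with m(1) show "N \<in> (\<lambda>(m, n). m + n) ` ({m. G m \<noteq> 0} \<times> {n. F n \<noteq> 0})"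
      by (intro image_eqI[of _ _ "(m, N - m)"]) auto
  qed
  moreover have "finite ((\<lambda>(m, n). m + n) ` ({m. G m \<noteq> 0} \<times> {n. F n \<noteq> 0}))"
    using F G by (auto simp: DA_def)
  ultimately show ?thesis
    unfolding DA_def by (blast intro: finite_subset)
qed

text \<open>Both sides sum \<open>h a b c\<close> over \<open>a + b + c = N\<close>.\<close>

lemma sum_triangle_assoc:
  fixes h :: "nat \<Rightarrow> nat \<Rightarrow> nat \<Rightarrow> 'b::comm_monoid_add"
  shows "(\<Sum>m\<le>N. \<Sum>k\<le>m. h k (m - k) (N - m)) = (\<Sum>k\<le>N. \<Sum>j\<le>N - k. h k j (N - k - j))"
  by (simp add: sum.Sigma) (rule sum.reindex_bij_witness[where i = "\<lambda>(k, j). (k + j, k)" and j = "\<lambda>(m, k). (k, m - k)"], auto)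

lemma DA_mult_assoc:
  assumes H: "H \<in> DA scale" and G: "G \<in> DA scale" and F: "F \<in> DA scale"
  shows "DA_mult scale (DA_mult scale H G) F = DA_mult scale H (DA_mult scale G F)"
proof
  fix N
  let ?h = "\<lambda>a b c. diffop_comp scale a (b + c) (H a) (diffop_comp scale b c (G b) (F c))"
  have "DA_mult scale (DA_mult scale H G) F N = (\<Sum>m\<le>N. \<Sum>k\<le>m. ?h k (m - k) (N - m))"
    unfolding DA_mult_def
  proof (rule sum.cong[OF refl])
    fix m assume "m \<in> {..N}"
    have "diffop_comp scale m (N - m) (\<Sum>k\<le>m. diffop_comp scale k (m - k) (H k) (G (m - k))) (F (N - m)) =
        (\<Sum>k\<le>m. diffop_comp scale m (N - m) (diffop_comp scale k (m - k) (H k) (G (m - k))) (F (N - m)))"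
      by (rule comp_sum_left) (use mult_diffop[OF H G] in simp)
    also have "\<dots> = (\<Sum>k\<le>m. ?h k (m - k) (N - m))"
    proof (rule sum.cong[OF refl])
      fix k assume "k \<in> {..m}"
      then have "k + (m - k) = m" by simp
      with comp_assoc_diffop[OF DA_diffop[OF H] DA_diffop[OF G] DA_diffop[OF F], of k "m - k" "N - m"]
      show "diffop_comp scale m (N - m) (diffop_comp scale k (m - k) (H k) (G (m - k))) (F (N - m)) =
          ?h k (m - k) (N - m)" by simp
    qed
    finally show "diffop_comp scale m (N - m) (\<Sum>k\<le>m. diffop_comp scale k (m - k) (H k) (G (m - k))) (F (N - m)) =
        (\<Sum>k\<le>m. ?h k (m - k) (N - m))" .
  qed
  also have "\<dots> = (\<Sum>k\<le>N. \<Sum>j\<le>N - k. ?h k j (N - k - j))"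
    by (rule sum_triangle_assoc)
  also have "\<dots> = DA_mult scale H (DA_mult scale G F) N"
    unfolding DA_mult_def
  proof (rule sum.cong[OF refl])
    fix k assume "k \<in> {..N}"
    have "diffop_comp scale k (N - k) (H k) (\<Sum>j\<le>N - k. diffop_comp scale j (N - k - j) (G j) (F (N - k - j))) =
        (\<Sum>j\<le>N - k. diffop_comp scale k (N - k) (H k) (diffop_comp scale j (N - k - j) (G j) (F (N - k - j))))"
      by (rule comp_sum_right[OF DA_diffop[OF H]]) (rule mult_diffop[OF G F], simp)
    also have "\<dots> = (\<Sum>j\<le>N - k. ?h k j (N - k - j))"
      by (rule sum.cong[OF refl]) (simp only: atMost_iff le_add_diff_inverse)
    finally show "(\<Sum>j\<le>N - k. ?h k j (N - k - j)) =
        diffop_comp scale k (N - k) (H k) (\<Sum>j\<le>N - k. diffop_comp scale j (N - k - j) (G j) (F (N - k - j)))" ..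
  qed
  finally show "DA_mult scale (DA_mult scale H G) F N = DA_mult scale H (DA_mult scale G F) N" .
qed

lemma DA_one_zero: "0 < n \<Longrightarrow> DA_one scale n = 0"
  by (rule ext) (simp add: DA_one_def)

lemma DA_one_closed: "DA_one scale \<in> DA scale"
proof -
  have "DA_one scale n \<in> diffop scale n" for n
    by (cases "n = 0") (simp_all add: diffop_one DA_one_zero diffop_zero)
  moreover have "{n. DA_one scale n \<noteq> 0} \<subseteq> {0}"
    using DA_one_zero by auto
  then have "finite {n. DA_one scale n \<noteq> 0}" by (rule finite_subset) simp
  ultimately show ?thesis by (simp add: DA_def)
qed

lemma DA_one_left:
  assumes "F \<in> DA scale" shows "DA_mult scale (DA_one scale) F = F"
proof
  fix N
  have "DA_mult scale (DA_one scale) F N =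
      (\<Sum>m\<le>N. if m = 0 then diffop_comp scale 0 N (DA_one scale 0) (F N) else 0)"
    unfolding DA_mult_def by (rule sum.cong) (auto simp: DA_one_zero comp_zero_left)
  also have "\<dots> = F N"
    by (simp add: sum.delta comp_one_left[OF DA_diffop[OF assms]])
  finally show "DA_mult scale (DA_one scale) F N = F N" .
qed

lemma DA_one_right:
  assumes "F \<in> DA scale" shows "DA_mult scale F (DA_one scale) = F"
proof
  fix N
  have "DA_mult scale F (DA_one scale) N =
      (\<Sum>m\<le>N. if m = N then diffop_comp scale N 0 (F N) (DA_one scale 0) else 0)"
    unfolding DA_mult_def
    by (rule sum.cong) (auto simp: DA_one_zero comp_zero_right[OF DA_diffop[OF assms]])
  also have "\<dots> = F N"
    by (simp add: sum.delta comp_one_right[OF DA_diffop[OF assms]])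
  finally show "DA_mult scale F (DA_one scale) N = F N" .
qed

lemma DA_algebra: "assoc_algebra_on (DA scale) DA_scale (DA_mult scale) (DA_one scale)"
proof (intro assoc_algebra_on.intro assoc_algebra_on_axioms.intro vector_space_DA subspace_DA
    DA_mult_closed DA_one_closed DA_mult_assoc DA_one_left DA_one_right)
  fix F G H assume D: "F \<in> DA scale" "G \<in> DA scale" "H \<in> DA scale"
  show "DA_mult scale (F + G) H = DA_mult scale F H + DA_mult scale G H"
    by (rule ext) (simp only: plus_fun_apply[of "DA_mult scale F H"] DA_mult_def plus_fun_apply[of F G]
      comp_add_left DA_diffop[OF D(1)] DA_diffop[OF D(2)] sum.distrib)
  show "DA_mult scale F (G + H) = DA_mult scale F G + DA_mult scale F H"
    by (rule ext) (simp only: plus_fun_apply[of "DA_mult scale F G"] DA_mult_def plus_fun_apply[of G H]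
      comp_add_right[OF DA_diffop[OF D(1)] DA_diffop[OF D(2)] DA_diffop[OF D(3)]] sum.distrib)
next
  fix F G c assume D: "F \<in> DA scale" "G \<in> DA scale"
  show "DA_mult scale (DA_scale c F) G = DA_scale c (DA_mult scale F G)"
    by (rule ext) (simp only: DA_mult_def DA_scale_eq comp_fscale_left[OF DA_diffop[OF D(1)]] fscale_sum)
  show "DA_mult scale F (DA_scale c G) = DA_scale c (DA_mult scale F G)"
    by (rule ext) (simp only: DA_mult_def DA_scale_eq
      comp_fscale_right[OF DA_diffop[OF D(1)] DA_diffop[OF D(2)]] fscale_sum)
qed

end

theorem proposition2p2p1:
  fixes scale :: "'k::field \<Rightarrow> 'a::{ring,monoid_mult} \<Rightarrow> 'a"
  assumes "assoc_algebra_on (UNIV :: 'a set) scale (*) 1"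
  shows "(\<forall>m n P Q. P \<in> diffop scale n \<longrightarrow> Q \<in> diffop scale m \<longrightarrow>
            diffop_comp scale m n Q P \<in> diffop scale (m + n) \<and>
            (\<forall>d\<ge>1. \<forall>l \<in> opart d (m + n).
               extend scale (diffop_comp scale m n Q P) l = comp_sum scale m n Q P l)) \<and>
         assoc_algebra_on (DA scale) DA_scale (DA_mult scale) (DA_one scale)"
proof -
  interpret unital_algebra scale by (rule unital_algebra.intro[OF assms])
  have "extend scale (diffop_comp scale m n Q P) l = comp_sum scale m n Q P l"
    if "P \<in> diffop scale n" "Q \<in> diffop scale m" "1 \<le> d" "l \<in> opart d (m + n)" for m n P Q d l
    unfolding comp_sum_eq
    by (rule extend_diffop_comp[OF that(1,2)]) (use that(3,4) in \<open>auto simp: opart_def\<close>)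
  then show ?thesis using diffop_comp_diffop DA_algebra by blast
qed

end
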